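(* Let $0<k<1$ be the modulus, $z:=2K(k)/\pi$, and $q:=\exp(-\pi K(\sqrt{1-k^2})/K(k))$. Then $$(kz)^6=4\det\begin{pmatrix} T_0(q) & T_2(q) \\ T_2(q) & T_4(q) \end{pmatrix}+4\det\begin{pmatrix} \widehat{T}_0(q) & \widehat{T}_2(q) \\ \widehat{T}_2(q) & \widehat{T}_4(q) \end{pmatrix},$$ $$k^4z^6=4\det\begin{pmatrix} T_0(q) & T_2(q) \\ T_2(q) & T_4(q) \end{pmatrix},$$ $$k^2z^6=4^2N_4(q)+4^3\det\begin{pmatrix} N_0(q) & N_2(q) \\ N_2(q) & N_4(q) \end{pmatrix},$$ $$z^6=4^2N_4(q)+4^3\det\begin{pmatrix} N_0(q) & N_2(q) \\ N_2(q) & N_4(q) \end{pmatrix}+\tfrac14\det\begin{pmatrix} 4R_0(-q)-1 & 4R_2(-q)+1 \\ 4R_2(-q)+1 & 4R_4(-q)-5 \end{pmatrix}.$$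
   Context: $K(k):=\int_0^1\frac{dt}{\sqrt{(1-t^2)(1-k^2t^2)}}$ is the complete elliptic integral of the first kind. For $m\ge0$ and $|x|<1$: $$T_{2m}(x)=\sum_{r\ge1}\frac{(2r-1)^{2m}x^{r-1/2}}{1+x^{2r-1}},\qquad \widehat{T}_{2m}(x)=\sum_{r\ge1}\frac{(2r-1)^{2m}(-1)^rx^{r-1/2}}{1-x^{2r-1}},$$ $$N_{2m}(x)=\sum_{r\ge1}\frac{r^{2m}x^r}{1+x^{2r}},\qquad R_{2m}(x)=\sum_{r\ge1}(-1)^{r+1}\frac{(2r-1)^{2m}x^{2r-1}}{1+x^{2r-1}}.$$ Half-integer powers of $q\in(0,1)$ are the positive ones. *)

theory Defs
  imports "HOL-Analysis.Analysis"
begin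

(* The integrand is unbounded as t tends to 1. It is nonnegative for |k| < 1, so the
   Henstock-Kurzweil integral agrees with the improper Riemann integral; the value 1 / 0 = 0
   at the endpoint t = 1 is irrelevant. *)
definition ellipticK :: "real \<Rightarrow> real" where
  "ellipticK k = integral {0..1} (\<lambda>t. 1 / sqrt ((1 - t\<^sup>2) * (1 - k\<^sup>2 * t\<^sup>2)))"

(* The first argument m of the following series stands for the subscript 2m, so that
   serT 0, serT 1, serT 2 are T_0, T_2, T_4. All four converge absolutely for |x| < 1, hence
   the unordered sums are the ordinary series. The half-integer powers in serT and serThat
   are meant for x > 0 only. *)

definition serT :: "nat \<Rightarrow> real \<Rightarrow> real" where
  "serT m x = (\<Sum>\<^sub>\<infinity>r\<in>{1::nat..}.
     (2 * real r - 1) ^ (2 * m) * x powr (real r - 1 / 2) / (1 + x ^ (2 * r - 1)))"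

definition serThat :: "nat \<Rightarrow> real \<Rightarrow> real" where
  "serThat m x = (\<Sum>\<^sub>\<infinity>r\<in>{1::nat..}.
     (2 * real r - 1) ^ (2 * m) * (- 1) ^ r * x powr (real r - 1 / 2) / (1 - x ^ (2 * r - 1)))"

definition serN :: "nat \<Rightarrow> real \<Rightarrow> real" where
  "serN m x = (\<Sum>\<^sub>\<infinity>r\<in>{1::nat..}. real r ^ (2 * m) * x ^ r / (1 + x ^ (2 * r)))"

definition serR :: "nat \<Rightarrow> real \<Rightarrow> real" where
  "serR m x = (\<Sum>\<^sub>\<infinity>r\<in>{1::nat..}.
     (- 1) ^ (r + 1) * ((2 * real r - 1) ^ (2 * m) * x ^ (2 * r - 1) / (1 + x ^ (2 * r - 1))))"

abbreviation mat2 :: "real \<Rightarrow> real \<Rightarrow> real \<Rightarrow> real \<Rightarrow> real ^ 2 ^ 2" where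
  "mat2 a b c d \<equiv> vector [vector [a, b], vector [c, d]]"

end

(*
The Lambert series T, N, That and R(-q) are the even Taylor coefficients of the Fourier series of
the Jacobian functions cn and dn at 0 and of sn and 1/sn at a quarter period.  With q = exp(-2h) and
z = i theta, the functions
  cn z = sum over odd j of exp(jz) / cosh(jh),   dn z = sum over even j of exp(jz) / cosh(jh),
  sn z = sum over odd j of exp(jz) / sinh(jh)
satisfy cn' = sn dn, sn' = cn dn, dn' = sn cn in the strip |Re z| < h: by the addition theorems, each
coefficient of a product is a telescoping sum of values of tanh and coth.  These equations give the
derivatives in terms of c0 = cn 0 and d0 = dn 0.  They also show that t = sn/(i c0) on the segment from
0 to i pi/2 and t = sn/cn on the segment from 0 to h uniformise the elliptic integrals of modulus
c0/d0 and of the complementary modulus, whence K = d0 pi/2 and K' = d0 h.  As K'/K is strictly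
decreasing in the modulus, k = c0/d0 and z = d0.
*)
theory Submission
  imports Defs
begin

section \<open>Bilateral exponential series in a vertical strip\<close>

text \<open>Why the determinants are so simple: each is, up to normalisation,
  \<open>y * y'''' - y''^2\<close> at a critical point of a solution of
  \<open>y'' = 2 y^3 + a y\<close>. At such a point \<open>y'''' = (6 y^2 + a) y''\<close>, so the
  determinant collapses to \<open>4 y^3 y''\<close>. For cn and dn this is
  \<open>4 c0^4 d0^2\<close> and \<open>4 c0^2 d0^4\<close>, which are the second and third
  identities. For sn and its reciprocal a factor \<open>d0^2 - c0^2\<close> appears, and adding the
  cn or dn determinant turns it into the pure sixth powers of the first and fourth identities. The
  isolated N_4 term comes from the constant Fourier coefficient 1 of dn. The constants -1, 1, -5
  beside the R series come from the cosecant that has to be split off from 1/sn, whose own Fourier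
  coefficients do not decay. The Fourier coefficients are explicit in \<open>h\<close>, not in the
  modulus. Hence the construction starts from \<open>h\<close>, and the modulus is recovered only at
  the end by injectivity of K'/K.\<close>

lemma summable_on_exp_abs_int:
  assumes "\<delta> > 0"
  shows "(\<lambda>j::int. exp (- \<delta> * \<bar>real_of_int j\<bar>)) summable_on UNIV"
proof -
  have "summable (\<lambda>n. exp (- \<delta>) ^ n)"
    using assms by (intro summable_geometric) auto
  hence nat: "(\<lambda>n. exp (- \<delta> * real n)) summable_on UNIV"
    by (subst summable_on_UNIV_nonneg_real_iff) (auto simp: exp_of_nat_mult[symmetric] mult.commute)
  have "(\<lambda>j::int. exp (- \<delta> * \<bar>real_of_int j\<bar>)) summable_on (range int)"
    using nat by (subst summable_on_reindex) (auto simp: o_def)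
  moreover have "(\<lambda>j::int. exp (- \<delta> * \<bar>real_of_int j\<bar>)) summable_on (range (\<lambda>n. - int n))"
    using nat by (subst summable_on_reindex) (auto simp: o_def inj_on_def)
  moreover have "(UNIV :: int set) = range int \<union> range (\<lambda>n. - int n)"
    by (metis (mono_tags, lifting) UNIV_eq_I UnI1 UnI2 int_cases2 rangeI)
  ultimately show ?thesis
    by (metis summable_on_union)
qed

definition expsum :: "(int \<Rightarrow> complex) \<Rightarrow> complex \<Rightarrow> complex" where
  "expsum a z = (\<Sum>\<^sub>\<infinity>j. a j * exp (of_int j * z))"

text \<open>Decay is required at every rate \<open>h' < h\<close> rather than at rate
  \<open>h\<close> itself. This makes the class stable under multiplication by \<open>j\<close>,
  that is, under differentiation of the series.\<close>

definition strip_coeffs :: "real \<Rightarrow> (int \<Rightarrow> complex) \<Rightarrow> bool" where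
  "strip_coeffs h a \<longleftrightarrow> (\<forall>h'<h. \<exists>M. \<forall>j. norm (a j) \<le> M * exp (- h' * \<bar>real_of_int j\<bar>))"

lemma strip_coeffsD:
  assumes "strip_coeffs h a" "h' < h"
  obtains M where "M \<ge> 0" "\<And>j. norm (a j) \<le> M * exp (- h' * \<bar>real_of_int j\<bar>)"
proof -
  obtain M where M: "norm (a j) \<le> M * exp (- h' * \<bar>real_of_int j\<bar>)" for j
    using assms unfolding strip_coeffs_def by blast
  moreover have "M \<ge> 0"
    using M[of 0] norm_ge_zero[of "a 0"] by (simp del: norm_ge_zero)
  ultimately show ?thesis using that by blast
qed

lemma strip_coeffsI:
  assumes "\<And>j. norm (a j) \<le> M * exp (- h * \<bar>real_of_int j\<bar>)"
  shows "strip_coeffs h a"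
  unfolding strip_coeffs_def
proof (intro allI impI exI)
  fix h' j assume "h' < h"
  have "M \<ge> 0"
    using assms[of 0] norm_ge_zero[of "a 0"] by (simp del: norm_ge_zero)
  hence "M * exp (- h * \<bar>real_of_int j\<bar>) \<le> M * exp (- h' * \<bar>real_of_int j\<bar>)"
    using \<open>h' < h\<close> by (intro mult_left_mono) (auto intro!: mult_right_mono)
  thus "norm (a j) \<le> M * exp (- h' * \<bar>real_of_int j\<bar>)"
    using assms[of j] by linarith
qed

lemma strip_coeffs_bounded_mult:
  assumes "strip_coeffs h a" "\<And>j. norm (b j) \<le> B * norm (a j)"
  shows "strip_coeffs h b"
  unfolding strip_coeffs_def
proof (intro allI impI)
  fix h' assume "h' < h"
  then obtain M where M: "M \<ge> 0" "\<And>j. norm (a j) \<le> M * exp (- h' * \<bar>real_of_int j\<bar>)"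
    using assms strip_coeffsD by blast
  have "norm (b j) \<le> \<bar>B\<bar> * M * exp (- h' * \<bar>real_of_int j\<bar>)" for j
  proof -
    have "norm (b j) \<le> B * norm (a j)" by fact
    also have "\<dots> \<le> \<bar>B\<bar> * norm (a j)" by (intro mult_right_mono) auto
    also have "\<dots> \<le> \<bar>B\<bar> * (M * exp (- h' * \<bar>real_of_int j\<bar>))" 
      by (intro mult_left_mono M) auto
    finally show ?thesis by (simp add: mult_ac)
  qed
  thus "\<exists>M. \<forall>j. norm (b j) \<le> M * exp (- h' * \<bar>real_of_int j\<bar>)" by blast
qed

lemma strip_coeffs_cmult: "strip_coeffs h a \<Longrightarrow> strip_coeffs h (\<lambda>j. r * a j)"
  by (rule strip_coeffs_bounded_mult[where B = "norm r"]) (auto simp: norm_mult)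

lemma strip_coeffs_add:
  assumes "strip_coeffs h a" "strip_coeffs h b"
  shows "strip_coeffs h (\<lambda>j. a j + b j)"
  unfolding strip_coeffs_def
proof (intro allI impI)
  fix h' assume "h' < h"
  then obtain M N where M: "\<And>j. norm (a j) \<le> M * exp (- h' * \<bar>real_of_int j\<bar>)"
    and N: "\<And>j. norm (b j) \<le> N * exp (- h' * \<bar>real_of_int j\<bar>)"
    using assms strip_coeffsD by metis
  have "norm (a j + b j) \<le> (M + N) * exp (- h' * \<bar>real_of_int j\<bar>)" for j
    using M[of j] N[of j] norm_triangle_ineq[of "a j" "b j"] by (simp add: distrib_right)
  thus "\<exists>M. \<forall>j. norm (a j + b j) \<le> M * exp (- h' * \<bar>real_of_int j\<bar>)" by blast
qed

text \<open>Half of the gap between \<open>h'\<close> and \<open>h\<close> pays for the factor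
  \<open>j\<close>, because \<open>x <= exp (delta * x) / delta\<close>.\<close>

lemma strip_coeffs_times_index:
  assumes "strip_coeffs h a"
  shows "strip_coeffs h (\<lambda>j. of_int j * a j)"
  unfolding strip_coeffs_def
proof (intro allI impI)
  fix h' assume "h' < h"
  define \<delta> where "\<delta> = (h - h') / 2"
  have "\<delta> > 0" "h' + \<delta> < h" using \<open>h' < h\<close> by (auto simp: \<delta>_def field_simps)
  then obtain M where M: "M \<ge> 0" "\<And>j. norm (a j) \<le> M * exp (- (h' + \<delta>) * \<bar>real_of_int j\<bar>)"
    using assms strip_coeffsD by blast
  have "norm (of_int j * a j) \<le> M / \<delta> * exp (- h' * \<bar>real_of_int j\<bar>)" for j
  proof -
    let ?x = "\<bar>real_of_int j\<bar>"
    have "\<delta> * ?x \<le> exp (\<delta> * ?x)"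
      using exp_ge_add_one_self[of "\<delta> * ?x"] by linarith
    hence "?x \<le> exp (\<delta> * ?x) / \<delta>"
      using \<open>\<delta> > 0\<close> by (simp add: field_simps)
    hence "?x * norm (a j) \<le> (exp (\<delta> * ?x) / \<delta>) * (M * exp (- (h' + \<delta>) * ?x))"
      using M by (intro mult_mono) (use \<open>\<delta> > 0\<close> in auto)
    also have "\<dots> = M / \<delta> * exp (- h' * ?x)"
      by (simp add: exp_add ring_distribs exp_diff exp_minus field_simps)
    finally show ?thesis by (simp add: norm_mult)
  qed
  thus "\<exists>M. \<forall>j. norm (of_int j * a j) \<le> M * exp (- h' * \<bar>real_of_int j\<bar>)" by blast
qed

lemma strip_coeffs_shift:
  assumes "strip_coeffs h a"
  shows "strip_coeffs h (\<lambda>j. a (j + m))"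
  unfolding strip_coeffs_def
proof (intro allI impI)
  fix h' assume "h' < h"
  then obtain M where M: "M \<ge> 0" "\<And>j. norm (a j) \<le> M * exp (- h' * \<bar>real_of_int j\<bar>)"
    using assms strip_coeffsD by blast
  have "norm (a (j + m)) \<le> M * exp (\<bar>h'\<bar> * \<bar>real_of_int m\<bar>) * exp (- h' * \<bar>real_of_int j\<bar>)" for j
  proof -
    have "\<bar>h'\<bar> * (\<bar>real_of_int j\<bar> - \<bar>real_of_int (j + m)\<bar>) \<le> \<bar>h'\<bar> * \<bar>real_of_int m\<bar>"
      "\<bar>h'\<bar> * (\<bar>real_of_int (j + m)\<bar> - \<bar>real_of_int j\<bar>) \<le> \<bar>h'\<bar> * \<bar>real_of_int m\<bar>"
      by (intro mult_left_mono; linarith)+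
    hence "- h' * \<bar>real_of_int (j + m)\<bar> \<le> \<bar>h'\<bar> * \<bar>real_of_int m\<bar> + - h' * \<bar>real_of_int j\<bar>"
      by (cases "h' \<ge> 0") (auto simp: algebra_simps)
    hence "exp (- h' * \<bar>real_of_int (j + m)\<bar>) \<le> exp (\<bar>h'\<bar> * \<bar>real_of_int m\<bar>) * exp (- h' * \<bar>real_of_int j\<bar>)"
      by (simp add: exp_add[symmetric])
    hence "M * exp (- h' * \<bar>real_of_int (j + m)\<bar>) \<le> M * (exp (\<bar>h'\<bar> * \<bar>real_of_int m\<bar>) * exp (- h' * \<bar>real_of_int j\<bar>))"
      by (rule mult_left_mono) (use M in auto)
    thus ?thesis using M(2)[of "j + m"] by (simp only: mult.assoc)
  qed
  thus "\<exists>M. \<forall>j. norm (a (j + m)) \<le> M * exp (- h' * \<bar>real_of_int j\<bar>)" by blast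
qed

text \<open>The majorant does not depend on \<open>z\<close> in the closed substrip, so it serves
  both for absolute summability at one point and for uniform convergence.\<close>

lemma expsum_term_bound:
  assumes "strip_coeffs h a" "r < h"
  obtains M \<delta> where "\<delta> > 0" "\<And>j z. \<bar>Re z\<bar> \<le> r \<Longrightarrow> norm (a j * exp (of_int j * z)) \<le> M * exp (- \<delta> * \<bar>real_of_int j\<bar>)"
proof -
  define \<delta> where "\<delta> = (h - r) / 2"
  have "\<delta> > 0" "r + \<delta> < h" using assms by (auto simp: \<delta>_def field_simps)
  then obtain M where M: "M \<ge> 0" "\<And>j. norm (a j) \<le> M * exp (- (r + \<delta>) * \<bar>real_of_int j\<bar>)"
    using assms strip_coeffsD by blast
  have "norm (a j * exp (of_int j * z)) \<le> M * exp (- \<delta> * \<bar>real_of_int j\<bar>)"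
    if "\<bar>Re z\<bar> \<le> r" for j z
  proof -
    have "real_of_int j * Re z \<le> \<bar>real_of_int j\<bar> * \<bar>Re z\<bar>"
      by (metis abs_ge_self abs_mult)
    also have "\<dots> \<le> \<bar>real_of_int j\<bar> * r" using that by (intro mult_left_mono) auto
    finally have "norm (exp (of_int j * z)) \<le> exp (r * \<bar>real_of_int j\<bar>)"
      by (simp add: mult.commute)
    hence "norm (a j) * norm (exp (of_int j * z)) \<le> M * exp (- (r + \<delta>) * \<bar>real_of_int j\<bar>) * exp (r * \<bar>real_of_int j\<bar>)"
      using M by (intro mult_mono) auto
    also have "\<dots> = M * exp (- \<delta> * \<bar>real_of_int j\<bar>)"
      by (simp add: exp_add[symmetric] algebra_simps)
    finally show ?thesis by (simp add: norm_mult)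
  qed
  thus ?thesis using that \<open>\<delta> > 0\<close> by blast
qed

lemma expsum_abs_summable:
  assumes "strip_coeffs h a" "\<bar>Re z\<bar> < h"
  shows "(\<lambda>j. norm (a j * exp (of_int j * z))) summable_on UNIV"
proof -
  obtain M \<delta> where "\<delta> > 0" and *: "\<And>j w. \<bar>Re w\<bar> \<le> \<bar>Re z\<bar> \<Longrightarrow> norm (a j * exp (of_int j * w)) \<le> M * exp (- \<delta> * \<bar>real_of_int j\<bar>)"
    by (rule expsum_term_bound[OF assms]) blast
  have "(\<lambda>j. M * exp (- \<delta> * \<bar>real_of_int j\<bar>)) summable_on UNIV"
    by (rule summable_on_cmult_right[OF summable_on_exp_abs_int[OF \<open>\<delta> > 0\<close>]])
  thus ?thesis
    by (rule summable_on_comparison_test) (use * in auto)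
qed

lemma expsum_summable:
  assumes "strip_coeffs h a" "\<bar>Re z\<bar> < h"
  shows "(\<lambda>j. a j * exp (of_int j * z)) summable_on UNIV"
  using expsum_abs_summable[OF assms] by (rule abs_summable_summable)

lemma expsum_has_sum:
  assumes "strip_coeffs h a" "\<bar>Re z\<bar> < h"
  shows "((\<lambda>j. a j * exp (of_int j * z)) has_sum expsum a z) UNIV"
  unfolding expsum_def using expsum_summable[OF assms] by simp

lemma strip_coeffs_abs_summable:
  assumes "strip_coeffs h a" "h > 0"
  shows "(\<lambda>j. norm (a j)) summable_on UNIV"
  using expsum_abs_summable[OF assms(1), of 0] assms(2) by simp

lemma expsum_has_field_derivative:
  assumes a: "strip_coeffs h a" and z: "\<bar>Re z\<bar> < h"
  shows "(expsum a has_field_derivative expsum (\<lambda>j. of_int j * a j) z) (at z)"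
proof -
  define r where "r = (h + \<bar>Re z\<bar>) / 2"
  have r: "\<bar>Re z\<bar> < r" "r < h" using z by (auto simp: r_def field_simps)
  define S where "S = {w. - r < Re w} \<inter> {w. Re w < r}"
  have "open S" unfolding S_def by (intro open_Int open_halfspace_Re_gt open_halfspace_Re_lt)
  have "convex S" unfolding S_def by (intro convex_Int convex_halfspace_Re_gt convex_halfspace_Re_lt)
  have S: "\<bar>Re w\<bar> \<le> r" "\<bar>Re w\<bar> < h" if "w \<in> S" for w using that r by (auto simp: S_def)
  have "z \<in> S" using r by (auto simp: S_def)
  have a': "strip_coeffs h (\<lambda>j. of_int j * a j)" by (rule strip_coeffs_times_index[OF a])
  \<comment> \<open>Enumerating the integers turns the unordered bilateral sum into an ordinary
    series, to which the M-test and termwise differentiation apply.\<close>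
  have bij: "bij_betw int_decode UNIV UNIV" by (rule bij_int_decode)
  have nat: "(\<lambda>n. b (int_decode n) * exp (of_int (int_decode n) * w)) sums expsum b w"
    if "strip_coeffs h b" "w \<in> S" for b w
    using expsum_has_sum[OF that(1) S(2)[OF that(2)]] has_sum_reindex_bij_betw[OF bij]
    by (intro has_sum_imp_sums) fastforce
  obtain M \<delta> where "\<delta> > 0" and *: "\<And>j w. \<bar>Re w\<bar> \<le> r \<Longrightarrow> norm (of_int j * a j * exp (of_int j * w)) \<le> M * exp (- \<delta> * \<bar>real_of_int j\<bar>)"
    by (rule expsum_term_bound[OF a' r(2)]) blast
  let ?f = "\<lambda>n w. a (int_decode n) * exp (of_int (int_decode n) * w)"
  let ?f' = "\<lambda>n w. of_int (int_decode n) * a (int_decode n) * exp (of_int (int_decode n) * w)"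
  have summ: "summable (\<lambda>n. M * exp (- \<delta> * \<bar>real_of_int (int_decode n)\<bar>))"
    using summable_on_cmult_right[OF summable_on_exp_abs_int[OF \<open>\<delta> > 0\<close>], of M]
    by (intro summable_on_imp_summable)
      (subst summable_on_reindex_bij_betw[OF bij, of "\<lambda>j. M * exp (- \<delta> * \<bar>real_of_int j\<bar>)"])
  have "uniformly_convergent_on S (\<lambda>n w. \<Sum>i<n. ?f' i w)"
    by (rule Weierstrass_m_test'[OF _ summ]) (use * S in blast)
  moreover have "(?f n has_field_derivative ?f' n w) (at w within S)" for n w
    by (auto intro!: derivative_eq_intros)
  ultimately have "((\<lambda>w. \<Sum>n. ?f n w) has_field_derivative (\<Sum>n. ?f' n z)) (at z)"
    using \<open>open S\<close> \<open>z \<in> S\<close> nat[OF a \<open>z \<in> S\<close>]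
    by (intro has_field_derivative_series'(2)[OF \<open>convex S\<close>]) (auto simp: interior_open sums_iff)
  moreover have "(\<Sum>n. ?f' n z) = expsum (\<lambda>j. of_int j * a j) z"
    using nat[OF a' \<open>z \<in> S\<close>] by (simp add: sums_iff)
  moreover have "eventually (\<lambda>w. (\<Sum>n. ?f n w) = expsum a w) (nhds z)"
    using eventually_nhds_in_open[OF \<open>open S\<close> \<open>z \<in> S\<close>]
    by eventually_elim (use nat[OF a] in \<open>auto simp: sums_iff\<close>)
  ultimately show ?thesis
    by (auto simp: DERIV_cong_ev)
qed

lemma expsum_mult:
  assumes a: "strip_coeffs h a" and b: "strip_coeffs h b" and z: "\<bar>Re z\<bar> < h"
  shows "expsum a z * expsum b z = expsum (\<lambda>m. \<Sum>\<^sub>\<infinity>j. a j * b (m - j)) z"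
proof -
  let ?F = "\<lambda>j. a j * exp (of_int j * z)" and ?G = "\<lambda>j. b j * exp (of_int j * z)"
  have "(\<lambda>p. norm ((\<lambda>(j, l). ?F j * ?G l) p)) summable_on (UNIV \<times> UNIV)"
    unfolding Infinite_Sum.abs_summable_on_Sigma_iff
  proof (intro conjI ballI)
    fix j :: int
    show "(\<lambda>l. norm (case (j, l) of (j, l) \<Rightarrow> ?F j * ?G l)) summable_on UNIV"
      unfolding prod.case norm_mult[of "?F j"]
      by (rule summable_on_cmult_right[OF expsum_abs_summable[OF b z]])
  next
    have "(\<lambda>j. norm (?F j) * (\<Sum>\<^sub>\<infinity>l. norm (?G l))) summable_on UNIV"
      by (rule summable_on_cmult_left[OF expsum_abs_summable[OF a z]])
    moreover have "norm (\<Sum>\<^sub>\<infinity>l. norm (?F j * ?G l)) = norm (?F j) * (\<Sum>\<^sub>\<infinity>l. norm (?G l))" for j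
      unfolding norm_mult[of "?F j"] infsum_cmult_right'
      by (simp add: infsum_nonneg abs_mult)
    ultimately show "(\<lambda>j. norm (\<Sum>\<^sub>\<infinity>l. norm (case (j, l) of (j, l) \<Rightarrow> ?F j * ?G l))) summable_on UNIV"
      unfolding prod.case by presburger
  qed
  hence A: "(\<lambda>(j, l). ?F j * ?G l) summable_on (UNIV \<times> UNIV)"
    by (rule abs_summable_summable)
  \<comment> \<open>Regroups the absolutely summable double family by the total exponent
    \<open>m = j + l\<close>.\<close>
  have bij: "bij_betw (\<lambda>(m, j). (j, m - j)) (UNIV \<times> UNIV) (UNIV \<times> (UNIV :: int set))"
    by (rule bij_betwI[where g = "\<lambda>(j, l). (j + l, j)"]) auto
  have eq: "(case case p of (m, j) \<Rightarrow> (j, m - j) of (j, l) \<Rightarrow> ?F j * ?G l) =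
      (case p of (m, j) \<Rightarrow> a j * b (m - j) * exp (of_int m * z))" for p
    by (cases p) (simp add: exp_diff ring_distribs)
  have A': "(\<lambda>(m, j). a j * b (m - j) * exp (of_int m * z)) summable_on (UNIV \<times> UNIV)"
    using A summable_on_reindex_bij_betw[OF bij, of "\<lambda>(j, l). ?F j * ?G l"]
    unfolding eq by blast
  have "expsum a z * expsum b z = (\<Sum>\<^sub>\<infinity>j. \<Sum>\<^sub>\<infinity>l. ?F j * ?G l)"
    unfolding expsum_def
    by (simp add: infsum_cmult_left' infsum_cmult_right')
  also have "\<dots> = (\<Sum>\<^sub>\<infinity>(j, l). ?F j * ?G l)"
    using infsum_Sigma'_banach[OF A] by simp
  also have "\<dots> = (\<Sum>\<^sub>\<infinity>(m, j). a j * b (m - j) * exp (of_int m * z))"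
    using infsum_reindex_bij_betw[OF bij, of "\<lambda>(j, l). ?F j * ?G l"]
    unfolding eq by simp
  also have "\<dots> = (\<Sum>\<^sub>\<infinity>m. \<Sum>\<^sub>\<infinity>j. a j * b (m - j) * exp (of_int m * z))"
    using infsum_Sigma'_banach[OF A'] by simp
  also have "\<dots> = expsum (\<lambda>m. \<Sum>\<^sub>\<infinity>j. a j * b (m - j)) z"
    unfolding expsum_def by (simp add: infsum_cmult_left')
  finally show ?thesis .
qed

lemma strip_coeffs_conv_summable:
  assumes a: "strip_coeffs h a" and b: "strip_coeffs h b" and h: "h > 0"
  shows "(\<lambda>j. a j * b (m - j)) summable_on UNIV"
proof -
  \<comment> \<open>The rate 0 is admissible because \<open>h > 0\<close>; it says that
    \<open>b\<close> is bounded, so the decay of \<open>a\<close> alone gives convergence.\<close>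
  obtain M where M: "M \<ge> 0" "\<And>j. norm (b j) \<le> M * exp (- 0 * \<bar>real_of_int j\<bar>)"
    using strip_coeffsD[OF b h] by blast
  show ?thesis
  proof (rule abs_summable_summable, rule summable_on_comparison_test)
    show "(\<lambda>j. norm (a j) * M) summable_on UNIV"
      by (intro summable_on_cmult_left strip_coeffs_abs_summable[OF a h])
    show "norm (a j * b (m - j)) \<le> norm (a j) * M" for j
      unfolding norm_mult using M(2)[of "m - j"] by (intro mult_left_mono) auto
  qed auto
qed

lemma expsum_shift: "expsum (\<lambda>j. a (j + m)) z = exp (- of_int m * z) * expsum a z"
proof -
  have bij: "bij_betw (\<lambda>j. j + m) UNIV (UNIV :: int set)"
    by (rule bij_betwI[where g = "\<lambda>j. j - m"]) auto
  have "exp (- of_int m * z) * expsum a z = (\<Sum>\<^sub>\<infinity>j. exp (- of_int m * z) * (a (j + m) * exp (of_int (j + m) * z)))"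
    unfolding expsum_def infsum_reindex_bij_betw[OF bij, of "\<lambda>j. a j * exp (of_int j * z)", symmetric]
    by (rule infsum_cmult_right'[symmetric])
  also have "\<dots> = expsum (\<lambda>j. a (j + m)) z"
    unfolding expsum_def by (rule infsum_cong) (simp add: mult_ac exp_add[symmetric] ring_distribs)
  finally show ?thesis ..
qed

lemma expsum_cmult: "expsum (\<lambda>j. r * a j) z = r * expsum a z"
  unfolding expsum_def by (simp add: mult.assoc infsum_cmult_right')

lemma expsum_add:
  assumes "strip_coeffs h a" "strip_coeffs h b" "\<bar>Re z\<bar> < h"
  shows "expsum (\<lambda>j. a j + b j) z = expsum a z + expsum b z"
  unfolding expsum_def
  using infsum_add[OF expsum_summable[OF assms(1,3)] expsum_summable[OF assms(2,3)]]
  by (simp add: ring_distribs)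

lemma expsum_reflect: "expsum (\<lambda>j. a (- j)) z = expsum a (- z)"
  unfolding expsum_def
  using infsum_reindex_bij_betw[of uminus UNIV "UNIV :: int set" "\<lambda>j. a j * exp (of_int j * - z)"]
  by (simp add: bij_uminus)

lemma expsum_cnj:
  assumes "\<And>j. cnj (a j) = a j"
  shows "expsum a (cnj z) = cnj (expsum a z)"
  unfolding expsum_def infsum_cnj[symmetric] by (simp add: assms exp_cnj)

section \<open>Telescoping sums over the integers\<close>

text \<open>Symmetric intervals exhaust the integers, so an unordered sum may be evaluated along
  them, where telescoping leaves only boundary terms.\<close>

lemma tendsto_has_sum_int:
  assumes "(f has_sum s) (UNIV :: int set)"
  shows "(\<lambda>n. \<Sum>i\<in>{- int n..int n}. f i) \<longlonglongrightarrow> s"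
proof -
  have "filterlim (\<lambda>n. {- int n..int n}) (finite_subsets_at_top UNIV) sequentially"
    unfolding filterlim_finite_subsets_at_top
  proof safe
    fix X :: "int set" assume "finite X"
    have "eventually (\<lambda>n. \<bar>x\<bar> \<le> int n) sequentially" for x
      using eventually_ge_at_top[of "nat \<bar>x\<bar>"] by eventually_elim auto
    hence "eventually (\<lambda>n. \<forall>x\<in>X. \<bar>x\<bar> \<le> int n) sequentially"
      using \<open>finite X\<close> by (intro eventually_ball_finite) auto
    thus "eventually (\<lambda>n. finite {- int n..int n} \<and> X \<subseteq> {- int n..int n} \<and> {- int n..int n} \<subseteq> UNIV) sequentially"
      by eventually_elim fastforce
  qed
  thus ?thesis
    using assms unfolding has_sum_def by (auto dest: filterlim_compose)
qed

lemma tendsto_telescope_int: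
  fixes F :: "int \<Rightarrow> 'a :: real_normed_field"
  assumes A: "(F \<longlongrightarrow> A) at_top" and B: "(F \<longlongrightarrow> B) at_bot"
  shows "(\<lambda>n. \<Sum>i\<in>{- int n..int n}. F (i + int m) - F i) \<longlonglongrightarrow> of_nat m * (A - B)"
proof (induction m)
  case (Suc m)
  \<comment> \<open>Raising the shift from \<open>m\<close> to \<open>Suc m\<close> adds a sum of
    consecutive differences. Its two surviving boundary values tend to \<open>A\<close> and
    \<open>B\<close>.\<close>
  have tele: "(\<Sum>i\<in>{- int n..int n}. F (i + int (Suc m)) - F (i + int m)) = F (int n + int m + 1) - F (- int n + int m)" for n
  proof (induction n)
    case (Suc n)
    have "{- int (Suc n)..int (Suc n)} = insert (- int (Suc n)) (insert (int (Suc n)) {- int n..int n})"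
      by auto
    thus ?case using Suc by (simp add: add_ac)
  qed (simp add: add_ac)
  have "filterlim (\<lambda>n. int n + int m + 1) at_top sequentially"
    unfolding filterlim_at_top
  proof
    fix Z :: int
    show "eventually (\<lambda>n. Z \<le> int n + int m + 1) sequentially"
      using eventually_ge_at_top[of "nat Z"] by eventually_elim auto
  qed
  hence 1: "(\<lambda>n. F (int n + int m + 1)) \<longlonglongrightarrow> A"
    by (rule filterlim_compose[OF A])
  have "filterlim (\<lambda>n. - int n + int m) at_bot sequentially"
    unfolding filterlim_at_bot
  proof
    fix Z :: int
    show "eventually (\<lambda>n. - int n + int m \<le> Z) sequentially"
      using eventually_ge_at_top[of "nat (int m - Z)"] by eventually_elim auto
  qed
  hence 2: "(\<lambda>n. F (- int n + int m)) \<longlonglongrightarrow> B"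
    by (rule filterlim_compose[OF B])
  have "(\<lambda>n. (\<Sum>i\<in>{- int n..int n}. F (i + int (Suc m)) - F (i + int m)) + (\<Sum>i\<in>{- int n..int n}. F (i + int m) - F i)) 
      \<longlonglongrightarrow> (A - B) + of_nat m * (A - B)"
    unfolding tele by (intro tendsto_add tendsto_diff 1 2 Suc.IH)
  thus ?case by (simp add: sum.distrib[symmetric] algebra_simps)
qed auto

lemma has_sum_telescope_int:
  fixes F :: "int \<Rightarrow> 'a :: real_normed_field"
  assumes A: "(F \<longlongrightarrow> A) at_top" and B: "(F \<longlongrightarrow> B) at_bot"
    and s: "((\<lambda>i. F (i + m) - F i) has_sum s) UNIV"
  shows "s = of_int m * (A - B)"
proof (cases "m \<ge> 0")
  case True
  then obtain n where m: "m = int n" using nonneg_int_cases by blast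
  show ?thesis
    using LIMSEQ_unique[OF tendsto_has_sum_int[OF s] tendsto_telescope_int[OF A B, of n, folded m]] m by simp
next
  case False
  then obtain n where m: "- m = int n" by (metis int_cases2 minus_minus of_nat_0_le_iff)
  \<comment> \<open>A negative shift becomes the positive shift \<open>- m\<close> after translating
    the index and changing the sign of the sum.\<close>
  have bij: "bij_betw (\<lambda>i. i - m) UNIV UNIV"
    by (rule bij_betwI[where g = "\<lambda>i. i + m"]) auto
  have "((\<lambda>i. F (i + - m) - F i) has_sum - s) UNIV"
    using has_sum_uminusI[OF s] has_sum_reindex_bij_betw[OF bij, of "\<lambda>i. F i - F (i + m)" "- s"] by simp
  from LIMSEQ_unique[OF tendsto_has_sum_int[OF this] tendsto_telescope_int[OF A B, of n, folded m]]
  have "- s = of_nat n * (A - B)" .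
  also have "of_nat n = - (of_int m :: 'a)" using m by (metis of_int_minus of_int_of_nat_eq)
  finally show ?thesis by simp
qed

text \<open>Reflecting the summation index removes the odd function \<open>H\<close> and leaves a telescoping sum.\<close>
lemma infsum_parity_class_odd_functions:
  fixes G H :: "int \<Rightarrow> complex"
  assumes G: "\<And>j. G (- j) = - G j" and H: "\<And>j. H (- j) = - H j"
    and lim: "(G \<longlongrightarrow> 1) at_top"
    and summ: "(\<lambda>j. if even j = p then H j + G (m - j) else 0) summable_on UNIV"
  shows "(\<Sum>\<^sub>\<infinity>j. if even j = p then H j + G (m - j) else 0) = of_int m"
proof -
  let ?f = "\<lambda>j. if even j = p then H j + G (m - j) else 0"
  define s where "s = infsum ?f UNIV"
  define r :: int where "r = (if p then 0 else 1)"
  have s: "(?f has_sum s) UNIV" using summ by (simp add: s_def)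
  have "((\<lambda>j. ?f (- j)) has_sum s) UNIV"
    using s has_sum_reindex_bij_betw[of uminus UNIV UNIV ?f s] by (simp add: bij_uminus)
  from has_sum_add[OF s this] 
  have "((\<lambda>j. if even j = p then G (j + m) - G (j - m) else 0) has_sum (s + s)) UNIV"
  proof (rule iffD1[OF has_sum_cong, rotated])
    fix j show "?f j + ?f (- j) = (if even j = p then G (j + m) - G (j - m) else 0)"
      using G[of "j - m"] by (simp add: H add.commute)
  qed
  hence "((\<lambda>j. G (j + m) - G (j - m)) has_sum (s + s)) {j. even j = p}"
    by (rule iffD1[OF has_sum_cong_neutral, rotated -1]) auto
  moreover have "bij_betw (\<lambda>i. 2 * i + r) UNIV {j. even j = p}"
    by (rule bij_betwI[where g = "\<lambda>j. j div 2"]) (auto simp: r_def elim: oddE)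
  ultimately have "((\<lambda>i. G (2 * i + r + m) - G (2 * i + r - m)) has_sum (s + s)) UNIV"
    using has_sum_reindex_bij_betw[of "\<lambda>i. 2 * i + r" UNIV "{j. even j = p}" "\<lambda>j. G (j + m) - G (j - m)"] by blast
  \<comment> \<open>With \<open>j = 2 i + r\<close>, passing from \<open>j - m\<close> to
    \<open>j + m\<close> shifts \<open>i\<close> by \<open>m\<close>. The limits 1 and -1 of
    \<open>F\<close> then give \<open>2 m\<close>, which is twice the wanted sum.\<close>
  moreover define F where "F = (\<lambda>i. G (2 * i + r - m))"
  ultimately have F: "((\<lambda>i. F (i + m) - F i) has_sum (s + s)) UNIV"
    by (simp add: algebra_simps)
  have top: "filterlim (\<lambda>i::int. 2 * i + c) at_top at_top" for c
    unfolding filterlim_at_top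
  proof
    fix Z :: int
    show "eventually (\<lambda>i. Z \<le> 2 * i + c) at_top"
      using eventually_ge_at_top[of "\<bar>Z\<bar> + \<bar>c\<bar>"] by eventually_elim auto
  qed
  have A: "(F \<longlongrightarrow> 1) at_top"
    unfolding F_def using filterlim_compose[OF lim top[of "r - m"]] by (simp add: algebra_simps)
  have "((\<lambda>i. - G (2 * i + (m - r))) \<longlongrightarrow> - 1) at_top"
    by (intro tendsto_minus filterlim_compose[OF lim top])
  hence "((\<lambda>i. F (- i)) \<longlongrightarrow> - 1) at_top"
    unfolding F_def by (simp add: G[symmetric] algebra_simps)
  moreover have uminus: "filterlim (\<lambda>i::int. - i) at_top at_bot"
    unfolding filterlim_at_top
  proof
    fix Z :: int
    show "eventually (\<lambda>i. Z \<le> - i) at_bot"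
      using eventually_le_at_bot[of "- Z"] by eventually_elim auto
  qed
  ultimately have B: "(F \<longlongrightarrow> - 1) at_bot"
    using filterlim_compose[of "\<lambda>i. F (- i)" _ at_top uminus at_bot] uminus by simp
  have "s + s = of_int m * (1 - - 1)"
    by (rule has_sum_telescope_int[OF A B F])
  thus ?thesis by (simp add: s_def)
qed

text \<open>The common form of the three convolutions below: after multiplication by
  \<open>g m\<close>, an addition theorem splits the product into a function of \<open>j\<close>
  plus a function of \<open>m - j\<close>. If \<open>m\<close> has the wrong parity, every product
  has a zero factor.\<close>

lemma infsum_conv_parity_classes:
  fixes a b :: "int \<Rightarrow> complex"
  assumes a: "strip_coeffs h a" "\<And>j. even j \<noteq> p \<Longrightarrow> a j = 0"
    and b: "strip_coeffs h b" "\<And>j. even j \<noteq> p' \<Longrightarrow> b j = 0" and h: "h > 0"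
    and G: "\<And>j. G (- j) = - G j" and H: "\<And>j. H (- j) = - H j"
    and lim: "(G \<longlongrightarrow> 1) at_top"
    and g: "\<And>m. even m = (p = p') \<Longrightarrow> g m \<noteq> 0"
    and eq: "\<And>j m. even j = p \<Longrightarrow> even m = (p = p') \<Longrightarrow> a j * b (m - j) * g m = H j + G (m - j)"
  shows "(\<Sum>\<^sub>\<infinity>j. a j * b (m - j)) = (if even m = (p = p') then of_int m / g m else 0)"
proof (cases "even m = (p = p')")
  case True
  have *: "a j * b (m - j) * g m = (if even j = p then H j + G (m - j) else 0)" for j
    using eq[OF _ True, of j] a(2)[of j] by auto
  have "(\<lambda>j. a j * b (m - j) * g m) summable_on UNIV"
    by (intro summable_on_cmult_left strip_coeffs_conv_summable[OF a(1) b(1) h])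
  hence "(\<Sum>\<^sub>\<infinity>j. a j * b (m - j) * g m) = of_int m"
    unfolding * using G H lim by (rule infsum_parity_class_odd_functions[rotated 3])
  thus ?thesis using g[OF True] True unfolding infsum_cmult_left' by (simp add: eq_divide_eq)
next
  case False
  have "a j * b (m - j) = 0" for j
    using a(2)[of j] b(2)[of "m - j"] False by auto
  hence "(\<Sum>\<^sub>\<infinity>j. a j * b (m - j)) = 0" by (intro infsum_0) blast
  thus ?thesis using False by metis
qed

section \<open>Elliptic functions attached to a nome\<close>

lemma sech_bound: "1 / cosh (x :: real) \<le> 2 * exp (- \<bar>x\<bar>)"
proof -
  have "exp \<bar>x\<bar> \<le> 2 * cosh x"
    by (simp add: cosh_def abs_if)
  thus ?thesis by (simp add: exp_minus field_simps)
qed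

locale nome_parameter =
  fixes h :: real
  assumes h_pos: "h > 0"
begin

definition cn_coeff :: "int \<Rightarrow> complex" where
  "cn_coeff j = (if odd j then of_real (1 / cosh (of_int j * h)) else 0)"
definition sn_coeff :: "int \<Rightarrow> complex" where
  "sn_coeff j = (if odd j then of_real (1 / sinh (of_int j * h)) else 0)"
definition dn_coeff :: "int \<Rightarrow> complex" where
  "dn_coeff j = (if even j then of_real (1 / cosh (of_int j * h)) else 0)"

lemma strip_coeffs_cn: "strip_coeffs h cn_coeff" and strip_coeffs_dn: "strip_coeffs h dn_coeff"
  using h_pos sech_bound[of "of_int j * h" for j]
  by (intro strip_coeffsI[where M = 2]; simp add: cn_coeff_def dn_coeff_def norm_divide abs_mult mult_ac)+

text \<open>For odd \<open>j\<close> the point \<open>j * h\<close> stays at distance at least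
  \<open>h\<close> from the pole at 0, so one constant works for all coefficients of
  \<open>sn\<close>.\<close>

lemma csch_bound:
  assumes "\<bar>x\<bar> \<ge> h"
  shows "1 / \<bar>sinh x\<bar> \<le> 2 / (1 - exp (- 2 * h)) * exp (- \<bar>x\<bar>)"
proof -
  have "\<bar>sinh x\<bar> = sinh \<bar>x\<bar>" by (cases "x \<ge> 0") (auto simp: abs_if)
  also have "\<dots> = exp \<bar>x\<bar> * (1 - exp (- 2 * \<bar>x\<bar>)) / 2"
    by (simp add: sinh_def exp_diff exp_minus field_simps exp_add[symmetric])
  also have "\<dots> \<ge> exp \<bar>x\<bar> * (1 - exp (- 2 * h)) / 2"
    using assms by (intro divide_right_mono mult_left_mono) auto
  finally have *: "\<bar>sinh x\<bar> \<ge> exp \<bar>x\<bar> * (1 - exp (- 2 * h)) / 2" .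
  have "exp \<bar>x\<bar> * (1 - exp (- 2 * h)) / 2 > 0" using h_pos by simp
  hence "1 / \<bar>sinh x\<bar> \<le> 1 / (exp \<bar>x\<bar> * (1 - exp (- 2 * h)) / 2)"
    using * by (intro divide_left_mono mult_pos_pos) linarith+
  also have "\<dots> = 2 / (1 - exp (- 2 * h)) * exp (- \<bar>x\<bar>)"
    by (simp add: exp_minus field_simps)
  finally show ?thesis .
qed

lemma odd_abs_ge: "odd j \<Longrightarrow> \<bar>of_int j * h\<bar> \<ge> h"
proof -
  assume "odd j"
  hence "\<bar>j\<bar> \<ge> 1" by presburger
  hence "\<bar>real_of_int j\<bar> \<ge> 1" by linarith
  from mult_right_mono[OF this, of h] show ?thesis using h_pos by (simp add: abs_mult)
qed

lemma strip_coeffs_sn: "strip_coeffs h sn_coeff"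
proof (rule strip_coeffsI)
  fix j
  have "0 \<le> 2 / (1 - exp (- 2 * h)) * exp (- h * \<bar>real_of_int j\<bar>)"
    using h_pos by simp
  thus "norm (sn_coeff j) \<le> 2 / (1 - exp (- 2 * h)) * exp (- h * \<bar>real_of_int j\<bar>)"
    using csch_bound[OF odd_abs_ge, of j] h_pos
    by (auto simp: sn_coeff_def norm_divide abs_mult mult_ac)
qed

lemma odd_times_h_nonzero: "odd j \<Longrightarrow> of_int j * h \<noteq> 0"
  using h_pos by auto

lemma tanh_coeff_limit: "((\<lambda>j. complex_of_real (tanh (of_int j * h))) \<longlongrightarrow> 1) at_top"
proof -
  have "filterlim (\<lambda>j. of_int j * h) at_top at_top"
    by (rule filterlim_at_top_mult_tendsto_pos[OF tendsto_const h_pos filterlim_real_of_int_at_top])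
  from filterlim_compose[OF tanh_real_at_top this]
  have "((\<lambda>j. complex_of_real (tanh (of_int j * h))) \<longlongrightarrow> of_real 1) at_top"
    by (rule tendsto_of_real)
  thus ?thesis by simp
qed

text \<open>These are rescaled Jacobi functions on a rotated axis. With modulus
  \<open>c0 / d0\<close>, the values of \<open>cn\<close>, \<open>sn\<close>, \<open>dn\<close> at
  \<open>i * theta\<close> are \<open>c0\<close>, \<open>i * c0\<close>, \<open>d0\<close> times the
  Jacobi functions cn, sn, dn at \<open>d0 * theta\<close>.\<close>

definition cn :: "complex \<Rightarrow> complex" where "cn = expsum cn_coeff"
definition sn :: "complex \<Rightarrow> complex" where "sn = expsum sn_coeff"
definition dn :: "complex \<Rightarrow> complex" where "dn = expsum dn_coeff"

text \<open>The identity behind it is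
  \<open>sech a * sech b * sinh (a + b) = tanh a + tanh b\<close> for \<open>a = j h\<close>,
  \<open>b = (m - j) h\<close>. Odd \<open>m\<close> keeps \<open>sinh (m h)\<close> away from
  zero.\<close>

lemma conv_cn_dn: "(\<Sum>\<^sub>\<infinity>j. cn_coeff j * dn_coeff (m - j)) = of_int m * sn_coeff m"
  by (subst infsum_conv_parity_classes[OF strip_coeffs_cn _ strip_coeffs_dn _ h_pos, where p = False and p' = True
    and G = "\<lambda>j. of_real (tanh (of_int j * h))" and H = "\<lambda>j. of_real (tanh (of_int j * h))"
    and g = "\<lambda>m. of_real (sinh (of_int m * h))"])
   (use tanh_coeff_limit odd_times_h_nonzero sinh_add[of "of_int j * h" "of_int (m - j) * h" for j m] in
    \<open>auto simp: cn_coeff_def sn_coeff_def dn_coeff_def tanh_def field_simps simp flip: of_real_add of_real_mult\<close>)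

text \<open>Here, and for \<open>conv_sn_cn\<close>, the identity is
  \<open>csch a * sech b * cosh (a + b) = coth a + tanh b\<close>. The coth part depends on
  \<open>j\<close> only and so takes the place of \<open>H\<close>, which disappears by oddness; its
  singularity at 0 is avoided because \<open>j\<close> is odd.\<close>

lemma conv_sn_dn: "(\<Sum>\<^sub>\<infinity>j. sn_coeff j * dn_coeff (m - j)) = of_int m * cn_coeff m"
  by (subst infsum_conv_parity_classes[OF strip_coeffs_sn _ strip_coeffs_dn _ h_pos, where p = False and p' = True
    and G = "\<lambda>j. of_real (tanh (of_int j * h))" and H = "\<lambda>j. of_real (1 / tanh (of_int j * h))"
    and g = "\<lambda>m. of_real (cosh (of_int m * h))"])
   (use tanh_coeff_limit odd_times_h_nonzero cosh_add[of "of_int j * h" "of_int (m - j) * h" for j m] in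
    \<open>auto simp: cn_coeff_def sn_coeff_def dn_coeff_def tanh_def field_simps simp flip: of_real_add of_real_mult\<close>)

lemma conv_sn_cn: "(\<Sum>\<^sub>\<infinity>j. sn_coeff j * cn_coeff (m - j)) = of_int m * dn_coeff m"
  by (subst infsum_conv_parity_classes[OF strip_coeffs_sn _ strip_coeffs_cn _ h_pos, where p = False and p' = False
    and G = "\<lambda>j. of_real (tanh (of_int j * h))" and H = "\<lambda>j. of_real (1 / tanh (of_int j * h))"
    and g = "\<lambda>m. of_real (cosh (of_int m * h))"])
   (use tanh_coeff_limit odd_times_h_nonzero cosh_add[of "of_int j * h" "of_int (m - j) * h" for j m] in
    \<open>auto simp: cn_coeff_def sn_coeff_def dn_coeff_def tanh_def field_simps simp flip: of_real_add of_real_mult\<close>)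

lemma cn_has_derivative: "\<bar>Re z\<bar> < h \<Longrightarrow> (cn has_field_derivative sn z * dn z) (at z)"
  using expsum_has_field_derivative[OF strip_coeffs_cn] expsum_mult[OF strip_coeffs_sn strip_coeffs_dn]
  by (simp add: cn_def sn_def dn_def conv_sn_dn)

lemma sn_has_derivative: "\<bar>Re z\<bar> < h \<Longrightarrow> (sn has_field_derivative cn z * dn z) (at z)"
  using expsum_has_field_derivative[OF strip_coeffs_sn] expsum_mult[OF strip_coeffs_cn strip_coeffs_dn]
  by (simp add: cn_def sn_def dn_def conv_cn_dn)

lemma dn_has_derivative: "\<bar>Re z\<bar> < h \<Longrightarrow> (dn has_field_derivative sn z * cn z) (at z)"
  using expsum_has_field_derivative[OF strip_coeffs_dn] expsum_mult[OF strip_coeffs_sn strip_coeffs_cn]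
  by (simp add: cn_def sn_def dn_def conv_sn_cn)

lemma cn_minus [simp]: "cn (- z) = cn z"
  unfolding cn_def expsum_reflect[symmetric] by (rule arg_cong2[where f = expsum]) (auto simp: cn_coeff_def)
lemma dn_minus [simp]: "dn (- z) = dn z"
  unfolding dn_def expsum_reflect[symmetric] by (rule arg_cong2[where f = expsum]) (auto simp: dn_coeff_def)
lemma sn_minus [simp]: "sn (- z) = - sn z"
proof -
  have "(\<lambda>j. sn_coeff (- j)) = (\<lambda>j. - 1 * sn_coeff j)"
    by (auto simp: sn_coeff_def)
  thus ?thesis
    unfolding sn_def expsum_reflect[symmetric] using expsum_cmult[of "- 1" sn_coeff z] by simp
qed

lemma sn_0 [simp]: "sn 0 = 0"
  using sn_minus[of 0] by simp

lemma cn_cnj: "cn (cnj z) = cnj (cn z)" and sn_cnj: "sn (cnj z) = cnj (sn z)" and dn_cnj: "dn (cnj z) = cnj (dn z)"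
  unfolding cn_def sn_def dn_def
  by (rule expsum_cnj; simp add: cn_coeff_def sn_coeff_def dn_coeff_def)+

text \<open>The coefficient at \<open>L\<close> of the formal product of \<open>sn\<close> with the
  series of \<open>coth (j h) * exp (j z)\<close> over odd \<open>j\<close>, a multiple of 1/sn. The
  latter has bounded, non-decaying coefficients, so \<open>expsum_mult\<close> does not cover it,
  but each coefficient of the product converges by the decay of \<open>sn_coeff\<close>.\<close>

definition coth_sum :: "int \<Rightarrow> complex" where
  "coth_sum L = (\<Sum>\<^sub>\<infinity>j. (if odd j then of_real (1 / tanh (of_int j * h)) else 0) * sn_coeff (L - j))"

lemma coth_bound: "odd j \<Longrightarrow> \<bar>1 / tanh (of_int j * h)\<bar> \<le> 1 / tanh h"
proof -
  assume "odd j"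
  have "\<bar>1 / tanh (of_int j * h)\<bar> = 1 / tanh \<bar>of_int j * h\<bar>"
    by (cases "of_int j * h \<ge> 0") (auto simp: abs_if)
  also have "\<dots> \<le> 1 / tanh h"
    using odd_abs_ge[OF \<open>odd j\<close>] h_pos
    by (intro divide_left_mono mult_pos_pos iffD2[OF tanh_real_le_iff] iffD2[OF tanh_real_pos_iff]) linarith+
  finally show ?thesis .
qed

lemma coth_sum_summable:
  "(\<lambda>j. (if odd j then of_real (1 / tanh (of_int j * h)) else 0) * sn_coeff (L - j)) summable_on UNIV"
proof (rule abs_summable_summable, rule summable_on_comparison_test)
  have bij: "bij_betw (\<lambda>j. L - j) UNIV (UNIV :: int set)"
    by (rule bij_betwI[where g = "\<lambda>j. L - j"]) auto
  show "(\<lambda>j. 1 / tanh h * norm (sn_coeff (L - j))) summable_on UNIV"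
    using strip_coeffs_abs_summable[OF strip_coeffs_sn h_pos]
      summable_on_reindex_bij_betw[OF bij, of "\<lambda>j. norm (sn_coeff j)"]
    by (intro summable_on_cmult_right) blast
  fix j
  have "norm (if odd j then complex_of_real (1 / tanh (of_int j * h)) else 0) \<le> 1 / tanh h"
    using coth_bound[of j] h_pos unfolding if_distrib[of norm] norm_of_real by simp
  thus "norm ((if odd j then of_real (1 / tanh (of_int j * h)) else 0) * sn_coeff (L - j)) \<le> 1 / tanh h * norm (sn_coeff (L - j))"
    unfolding norm_mult by (rule mult_right_mono) auto
qed auto

lemma infsum_sn_coeff: "infsum sn_coeff UNIV = 0"
  using sn_0 by (simp add: sn_def expsum_def)

text \<open>Expanding \<open>cosh (j h)\<close> at \<open>j = L - (L - j)\<close> and reflecting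
  \<open>j\<close> to \<open>L - j\<close> shows that the sum \<open>S\<close> satisfies
  \<open>S = cosh (L h) * S - sinh (L h) * sn 0\<close>. As \<open>sn 0 = 0\<close> and
  \<open>cosh (L h)\<close> differs from 1, \<open>S\<close> vanishes.\<close>

lemma coth_sum_eq_0:
  assumes "even L" "L \<noteq> 0"
  shows "coth_sum L = 0"
proof -
  let ?k = "\<lambda>j::int. if odd j then complex_of_real (1 / tanh (of_int j * h)) else 0"
  have bij: "bij_betw (\<lambda>j. L - j) UNIV (UNIV :: int set)"
    by (rule bij_betwI[where g = "\<lambda>j. L - j"]) auto
  have 1: "((\<lambda>j. ?k j * sn_coeff (L - j)) has_sum coth_sum L) UNIV"
    unfolding coth_sum_def using coth_sum_summable by simp
  have 2: "((\<lambda>j. ?k (L - j) * sn_coeff j) has_sum coth_sum L) UNIV"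
    using 1 has_sum_reindex_bij_betw[OF bij, of "\<lambda>j. ?k j * sn_coeff (L - j)"] by simp
  have 3: "(sn_coeff has_sum 0) UNIV"
    using abs_summable_summable[OF strip_coeffs_abs_summable[OF strip_coeffs_sn h_pos]] infsum_sn_coeff
    by (simp add: has_sum_iff)
  have alg: "(C * y - S * y') / x / y' = C * (y / y' / x) - S / x" if "x \<noteq> 0" "y' \<noteq> 0" for C S x y y' :: real
    using that by (simp add: field_simps)
  have eq: "?k j * sn_coeff (L - j) = of_real (cosh (of_int L * h)) * (?k (L - j) * sn_coeff j) + (- of_real (sinh (of_int L * h))) * sn_coeff j" for j
  proof (cases "odd j")
    case True
    hence "odd (L - j)" using assms by simp
    have "cosh (of_int j * h) = cosh (of_int L * h) * cosh (of_int (L - j) * h) - sinh (of_int L * h) * sinh (of_int (L - j) * h)"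
      using cosh_diff[of "of_int L * h" "of_int (L - j) * h"] by (simp add: ring_distribs)
    hence "cosh (of_int j * h) / sinh (of_int j * h) / sinh (of_int (L - j) * h) =
       (cosh (of_int L * h) * cosh (of_int (L - j) * h) - sinh (of_int L * h) * sinh (of_int (L - j) * h)) / sinh (of_int j * h) / sinh (of_int (L - j) * h)"
      by simp
    also have "\<dots> = cosh (of_int L * h) * (cosh (of_int (L - j) * h) / sinh (of_int (L - j) * h) / sinh (of_int j * h)) - sinh (of_int L * h) / sinh (of_int j * h)"
      by (rule alg) (use odd_times_h_nonzero[OF \<open>odd (L - j)\<close>] odd_times_h_nonzero[OF \<open>odd j\<close>] in auto)
    finally have "complex_of_real (cosh (of_int j * h) / sinh (of_int j * h) / sinh (of_int (L - j) * h)) = of_real \<dots>"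
      by (rule arg_cong)
    thus ?thesis using True \<open>odd (L - j)\<close>
      unfolding sn_coeff_def tanh_def by simp
  qed (use assms in \<open>auto simp: sn_coeff_def\<close>)
  have "((\<lambda>j. ?k j * sn_coeff (L - j)) has_sum of_real (cosh (of_int L * h)) * coth_sum L + (- of_real (sinh (of_int L * h))) * 0) UNIV"
    by (subst eq) (intro has_sum_add has_sum_cmult_right 2 3)
  from has_sum_unique[OF 1 this] have "coth_sum L = of_real (cosh (of_int L * h)) * coth_sum L"
    by simp
  moreover have "complex_of_real (cosh (of_int L * h)) \<noteq> 1"
    using assms h_pos by (subst of_real_eq_1_iff) simp
  ultimately show ?thesis by simp
qed

end


lemma expsum_add_pi_i:
  assumes "\<And>j. even j \<noteq> p \<Longrightarrow> a j = 0"
  shows "expsum a (z + \<i> * of_real pi) = (if p then expsum a z else - expsum a z)"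
proof -
  have *: "a j * exp (of_int j * (z + \<i> * of_real pi)) = (if p then 1 else - 1) * (a j * exp (of_int j * z))" for j
  proof (cases "even j = p")
    case True
    have "exp (of_int j * (z + \<i> * of_real pi)) = exp (of_int j * z) * exp (\<i> * of_real pi) powi j"
      by (simp only: ring_distribs exp_add exp_power_int)
    also have "exp (\<i> * of_real pi) powi j = (if p then 1 else - 1)"
      using True by auto
    finally show ?thesis by simp
  qed (use assms in auto)
  have "expsum a (z + \<i> * of_real pi) = (if p then 1 else - 1) * expsum a z"
    unfolding expsum_def * by (rule infsum_cmult_right')
  thus ?thesis by simp
qed

lemma expsum_delta: "expsum (\<lambda>j. if j = 0 then 1 else 0) z = 1"
proof -
  have "((\<lambda>j::int. (if j = 0 then 1 else 0) * exp (of_int j * z)) has_sum 1) UNIV"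
    by (rule has_sum_finite_neutralI[where B = "{0}"]) auto
  thus ?thesis unfolding expsum_def by (rule infsumI)
qed

lemma strip_coeffs_delta: "strip_coeffs h (\<lambda>j. if j = 0 then 1 else 0)"
  by (rule strip_coeffsI[where M = 1]) auto

section \<open>The reciprocal of sn, regularised by the cosecant\<close>

lemma coth_minus_sgn_bound:
  assumes "x \<noteq> 0"
  shows "\<bar>1 / tanh x - sgn x\<bar> \<le> 1 / \<bar>sinh x :: real\<bar>"
proof -
  have *: "\<bar>1 / tanh x - sgn x\<bar> \<le> 1 / \<bar>sinh x\<bar>" if "x > 0" for x :: real
  proof -
    have "1 / tanh x - sgn x = (cosh x - sinh x) / sinh x"
      using that by (simp add: tanh_def diff_divide_distrib)
    also have "\<dots> = exp (- x) / sinh x" by (simp add: cosh_minus_sinh)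
    finally show ?thesis using that by (simp add: divide_right_mono)
  qed
  show ?thesis
    using *[of x] *[of "- x"] assms by (cases "x > 0") (auto simp: abs_minus_commute sgn_if)
qed

text \<open>Puts termwise antiderivatives into the same coefficient class; the term
  \<open>j = 0\<close> becomes 0 by the convention for division.\<close>

lemma norm_divide_of_int_le: "norm (a / of_int j :: complex) \<le> 1 * norm a"
proof (cases "j = 0")
  case False
  hence "\<bar>real_of_int j\<bar> \<ge> 1" by linarith
  thus ?thesis by (simp add: norm_divide field_simps mult_le_cancel_left1)
qed auto

context nome_parameter
begin

text \<open>The coefficients \<open>coth (j h)\<close> of \<open>1 / sn\<close> do not decay; subtracting \<open>sgn j\<close>, the formal
  coefficients of the cosecant, leaves a series that converges in the strip.\<close>
definition en_coeff :: "int \<Rightarrow> complex" where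
  "en_coeff j = (if odd j then of_real (1 / tanh (of_int j * h) - sgn (of_int j)) else 0)"

definition en :: "complex \<Rightarrow> complex" where "en = expsum en_coeff"

lemma strip_coeffs_en: "strip_coeffs h en_coeff"
proof (rule strip_coeffs_bounded_mult[OF strip_coeffs_sn, where B = 1])
  fix j
  have "sgn (of_int j * h) = sgn (of_int j)" using h_pos by (simp add: sgn_mult)
  thus "norm (en_coeff j) \<le> 1 * norm (sn_coeff j)"
    using coth_minus_sgn_bound[OF odd_times_h_nonzero, of j]
    unfolding en_coeff_def sn_coeff_def if_distrib[of norm] norm_of_real by (auto simp: abs_divide)
qed

text \<open>The coefficients of \<open>1 - sinh z * en z\<close>, that is, of \<open>sinh z\<close>
  times the difference of the cosecant and \<open>en\<close>. The factor \<open>sinh z\<close>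
  removes the pole of the cosecant, and its two exponentials become index shifts by 1 and
  -1.\<close>

definition vn_coeff :: "int \<Rightarrow> complex" where
  "vn_coeff j = (if j = 0 then 1 else 0) + (1 / 2 * en_coeff (j + 1) + (- 1 / 2) * en_coeff (j + - 1))"

lemma strip_coeffs_vn: "strip_coeffs h vn_coeff"
  unfolding vn_coeff_def
  by (intro strip_coeffs_add strip_coeffs_delta strip_coeffs_cmult strip_coeffs_shift strip_coeffs_en)

text \<open>The two values of \<open>sgn\<close> cancel unless \<open>j = 0\<close>; there their
  jump contributes -1, which the Kronecker delta compensates. Only the coth terms remain.\<close>

lemma vn_coeff_eq:
  "vn_coeff j = 1 / 2 * ((if odd (j + 1) then of_real (1 / tanh (of_int (j + 1) * h)) else 0)
     - (if odd (j - 1) then of_real (1 / tanh (of_int (j - 1) * h)) else 0))"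
proof (cases "even j")
  case True
  show ?thesis
  proof (cases "j = 0")
    case False
    hence "sgn (real_of_int (j + 1)) = sgn (real_of_int (j - 1))"
      using \<open>even j\<close> by (cases "j > 0") (auto simp: sgn_if)
    thus ?thesis using True False by (simp add: vn_coeff_def en_coeff_def algebra_simps)
  qed (simp add: vn_coeff_def en_coeff_def field_simps)
qed (auto simp: vn_coeff_def en_coeff_def)

lemma expsum_vn:
  assumes "\<bar>Re z\<bar> < h"
  shows "expsum vn_coeff z = 1 - sinh z * en z"
proof -
  note shift = strip_coeffs_shift[OF strip_coeffs_en]
  note 1 = strip_coeffs_cmult[OF shift, of "1 / 2" 1] and 2 = strip_coeffs_cmult[OF shift, of "- 1 / 2" "- 1"]
  have "expsum vn_coeff z = 1 + (1 / 2 * (exp (- z) * en z) + (- 1 / 2) * (exp z * en z))"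
    unfolding vn_coeff_def[abs_def] expsum_add[OF strip_coeffs_delta strip_coeffs_add[OF 1 2] assms] expsum_add[OF 1 2 assms]
      expsum_cmult expsum_shift expsum_delta en_def by simp
  thus ?thesis by (simp add: sinh_def algebra_simps scaleR_conv_of_real)
qed

lemma conv_vn_sn:
  "(\<Sum>\<^sub>\<infinity>j. vn_coeff j * sn_coeff (m - j)) = 1 / 2 * (coth_sum (m + 1) - coth_sum (m - 1))"
proof -
  let ?k = "\<lambda>j::int. if odd j then complex_of_real (1 / tanh (of_int j * h)) else 0"
  have hs: "((\<lambda>j. ?k (j + c) * sn_coeff (m - j)) has_sum coth_sum (m + c)) UNIV" for c
  proof -
    have bij: "bij_betw (\<lambda>j. j + c) UNIV (UNIV :: int set)"
      by (rule bij_betwI[where g = "\<lambda>j. j - c"]) auto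
    have "((\<lambda>j. ?k j * sn_coeff (m + c - j)) has_sum coth_sum (m + c)) UNIV"
      unfolding coth_sum_def using coth_sum_summable by simp
    thus ?thesis
      using has_sum_reindex_bij_betw[OF bij, of "\<lambda>j. ?k j * sn_coeff (m + c - j)"] by simp
  qed
  have "((\<lambda>j. 1 / 2 * (?k (j + 1) * sn_coeff (m - j)) + (- 1 / 2) * (?k (j + - 1) * sn_coeff (m - j)))
     has_sum 1 / 2 * coth_sum (m + 1) + (- 1 / 2) * coth_sum (m + - 1)) UNIV"
    by (intro has_sum_add has_sum_cmult_right hs)
  moreover have "1 / 2 * (?k (j + 1) * sn_coeff (m - j)) + (- 1 / 2) * (?k (j + - 1) * sn_coeff (m - j)) = vn_coeff j * sn_coeff (m - j)" for j
    unfolding vn_coeff_eq by (simp add: algebra_simps)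
  hence "(\<lambda>j. 1 / 2 * (?k (j + 1) * sn_coeff (m - j)) + (- 1 / 2) * (?k (j + - 1) * sn_coeff (m - j))) = (\<lambda>j. vn_coeff j * sn_coeff (m - j))"
    by (rule ext)
  ultimately have "((\<lambda>j. vn_coeff j * sn_coeff (m - j)) has_sum 1 / 2 * coth_sum (m + 1) + (- 1 / 2) * coth_sum (m + - 1)) UNIV"
    by (simp only:)
  hence "(\<Sum>\<^sub>\<infinity>j. vn_coeff j * sn_coeff (m - j)) = 1 / 2 * coth_sum (m + 1) + (- 1 / 2) * coth_sum (m + - 1)"
    by (rule infsumI)
  thus ?thesis by (simp add: algebra_simps)
qed

lemma coth_sum_eq_0': "L \<noteq> 0 \<Longrightarrow> coth_sum L = 0"
proof (cases "even L")
  case False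
  hence "(if odd j then of_real (1 / tanh (of_int j * h)) else 0) * sn_coeff (L - j) = 0" for j
    by (auto simp: sn_coeff_def)
  thus ?thesis unfolding coth_sum_def by (intro infsum_0) blast
qed (use coth_sum_eq_0 in blast)

text \<open>In the product with \<open>sn\<close>, the coefficient at \<open>m\<close> is half the
  difference of \<open>coth_sum\<close> at \<open>m + 1\<close> and \<open>m - 1\<close>. Only
  \<open>m = 1\<close> and \<open>m = -1\<close> survive, which leaves a multiple of
  \<open>sinh\<close>.\<close>

lemma sn_en_aux:
  assumes "\<bar>Re z\<bar> < h"
  shows "sn z * (1 - sinh z * en z) = - coth_sum 0 * sinh z"
proof -
  define \<delta> :: "int \<Rightarrow> complex" where "\<delta> = (\<lambda>j. if j = 0 then 1 else 0)"
  define a where "a = coth_sum 0 / 2"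
  have \<delta>: "strip_coeffs h \<delta>" "expsum \<delta> w = 1" for w
    unfolding \<delta>_def by (rule strip_coeffs_delta expsum_delta)+
  note shift = strip_coeffs_shift[OF \<delta>(1)]
  note 1 = strip_coeffs_cmult[OF shift, of a 1] and 2 = strip_coeffs_cmult[OF shift, of "- a" "- 1"]
  have "expsum vn_coeff z * sn z = expsum (\<lambda>m. 1 / 2 * (coth_sum (m + 1) - coth_sum (m - 1))) z"
    unfolding sn_def using expsum_mult[OF strip_coeffs_vn strip_coeffs_sn assms] by (simp only: conv_vn_sn)
  also have "(\<lambda>m. 1 / 2 * (coth_sum (m + 1) - coth_sum (m - 1))) = (\<lambda>m. a * \<delta> (m + 1) + (- a) * \<delta> (m + - 1))"
  proof
    fix m :: int
    consider "m = 1" | "m = - 1" | "m \<noteq> 1" "m \<noteq> - 1" by blast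
    thus "1 / 2 * (coth_sum (m + 1) - coth_sum (m - 1)) = a * \<delta> (m + 1) + (- a) * \<delta> (m + - 1)"
      by cases (auto simp: \<delta>_def a_def coth_sum_eq_0')
  qed
  also have "expsum \<dots> z = a * (exp (- z) * 1) + (- a) * (exp z * 1)"
    unfolding expsum_add[OF 1 2 assms] expsum_cmult expsum_shift \<delta>(2) by simp
  also have "\<dots> = - coth_sum 0 * sinh z"
    by (simp add: a_def sinh_def algebra_simps scaleR_conv_of_real)
  finally show ?thesis by (simp add: expsum_vn[OF assms] mult.commute)
qed

lemma open_strip: "open {z. \<bar>Re z\<bar> < h}" and convex_strip: "convex {z. \<bar>Re z\<bar> < h}"
proof -
  have eq: "{z. \<bar>Re z\<bar> < h} = {z. - h < Re z} \<inter> {z. Re z < h}" by (auto simp: abs_less_iff)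
  show "open {z. \<bar>Re z\<bar> < h}" unfolding eq by (intro open_Int open_halfspace_Re_gt open_halfspace_Re_lt)
  show "convex {z. \<bar>Re z\<bar> < h}" unfolding eq by (intro convex_Int convex_halfspace_Re_gt convex_halfspace_Re_lt)
qed

lemma strip_constant:
  assumes "\<And>z. \<bar>Re z\<bar> < h \<Longrightarrow> (f has_field_derivative 0) (at z)" "\<bar>Re z\<bar> < h"
  shows "f z = f 0"
proof -
  obtain c where c: "\<forall>z\<in>{z. \<bar>Re z\<bar> < h}. f z = c"
    using has_field_derivative_zero_constant[OF convex_strip, of f] assms(1) has_field_derivative_at_within by blast
  show ?thesis using bspec[OF c, of z] bspec[OF c, of 0] assms(2) h_pos by simp
qed

lemma en_has_derivative: "\<bar>Re z\<bar> < h \<Longrightarrow> (en has_field_derivative expsum (\<lambda>j. of_int j * en_coeff j) z) (at z)"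
  unfolding en_def by (rule expsum_has_field_derivative[OF strip_coeffs_en])

text \<open>The constant \<open>coth_sum 0\<close> is found by comparing derivatives at 0, where
  \<open>sn\<close> vanishes and has slope \<open>cn 0 * dn 0\<close>. The result says that
  \<open>cn 0 * dn 0 / sn\<close> is the cosecant minus \<open>en\<close>.\<close>

lemma sn_en:
  assumes "\<bar>Re z\<bar> < h"
  shows "sn z * (1 - sinh z * en z) = cn 0 * dn 0 * sinh z"
proof -
  have 0: "\<bar>Re 0\<bar> < h" using h_pos by simp
  have der: "((\<lambda>z. sn z * (1 - sinh z * en z)) has_field_derivative cn 0 * dn 0) (at 0)"
    by (auto intro!: derivative_eq_intros sn_has_derivative[OF 0] en_has_derivative[OF 0])
  have "((\<lambda>z. - coth_sum 0 * sinh z) has_field_derivative - coth_sum 0) (at 0)"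
    by (auto intro!: derivative_eq_intros)
  moreover have "eventually (\<lambda>z. sn z * (1 - sinh z * en z) = - coth_sum 0 * sinh z) (nhds 0)"
    using eventually_nhds_in_open[OF open_strip, of 0] 0
    by (auto elim!: eventually_mono simp: sn_en_aux)
  ultimately have "((\<lambda>z. sn z * (1 - sinh z * en z)) has_field_derivative - coth_sum 0) (at 0)"
    by (subst DERIV_cong_ev[OF refl _ refl])
  from DERIV_unique[OF der this] have "cn 0 * dn 0 = - coth_sum 0" .
  thus ?thesis using sn_en_aux[OF assms] by simp
qed

section \<open>First integrals, the amplitude, and exponential formulas\<close>

lemma cn_sn_sq:
  assumes "\<bar>Re z\<bar> < h"
  shows "cn z ^ 2 - sn z ^ 2 = cn 0 ^ 2"
proof -
  have "((\<lambda>z. cn z ^ 2 - sn z ^ 2) has_field_derivative 0) (at z)" if "\<bar>Re z\<bar> < h" for z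
    by (rule derivative_eq_intros cn_has_derivative[OF that] sn_has_derivative[OF that] refl)+ simp
  from strip_constant[OF this assms] show ?thesis by simp
qed

lemma dn_sn_sq:
  assumes "\<bar>Re z\<bar> < h"
  shows "dn z ^ 2 - sn z ^ 2 = dn 0 ^ 2"
proof -
  have "((\<lambda>z. dn z ^ 2 - sn z ^ 2) has_field_derivative 0) (at z)" if "\<bar>Re z\<bar> < h" for z
    by (rule derivative_eq_intros dn_has_derivative[OF that] sn_has_derivative[OF that] refl)+ simp
  from strip_constant[OF this assms] show ?thesis by simp
qed

text \<open>The term \<open>j = 0\<close> of the series is \<open>dn_coeff 0 / 0 = 0\<close>; the summand \<open>z\<close> stands for it.\<close>
definition am :: "complex \<Rightarrow> complex" where
  "am z = z + expsum (\<lambda>j. dn_coeff j / of_int j) z"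

lemma am_has_derivative:
  assumes "\<bar>Re z\<bar> < h"
  shows "(am has_field_derivative dn z) (at z)"
proof -
  let ?a = "\<lambda>j. dn_coeff j / of_int j"
  have strip: "strip_coeffs h ?a"
    by (rule strip_coeffs_bounded_mult[OF strip_coeffs_dn norm_divide_of_int_le])
  have eq: "(\<lambda>j. (if j = 0 then 1 else 0) + of_int j * ?a j) = dn_coeff"
    by (auto simp: dn_coeff_def)
  have "dn z = 1 + expsum (\<lambda>j. of_int j * ?a j) z"
    using expsum_add[OF strip_coeffs_delta strip_coeffs_times_index[OF strip] assms]
    unfolding eq expsum_delta dn_def .
  moreover have "(am has_field_derivative 1 + expsum (\<lambda>j. of_int j * ?a j) z) (at z)"
    unfolding am_def by (intro DERIV_add DERIV_ident expsum_has_field_derivative[OF strip assms])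
  ultimately show ?thesis by simp
qed

lemma am_minus: "am (- z) = - am z"
proof -
  have "(\<lambda>j. dn_coeff (- j) / of_int (- j)) = (\<lambda>j. - 1 * (dn_coeff j / of_int j))"
    by (auto simp: dn_coeff_def)
  hence "expsum (\<lambda>j. dn_coeff j / of_int j) (- z) = - expsum (\<lambda>j. dn_coeff j / of_int j) z"
    unfolding expsum_reflect[symmetric] using expsum_cmult[of "- 1" "\<lambda>j. dn_coeff j / of_int j" z] by simp
  thus ?thesis by (simp add: am_def)
qed

lemma am_0 [simp]: "am 0 = 0"
  using am_minus[of 0] by simp

text \<open>The series part has period \<open>i pi\<close>, so \<open>am\<close> grows by
  \<open>i pi\<close> over that step. Oddness then fixes the value at the midpoint, by starting the
  step at \<open>- i pi / 2\<close>.\<close>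

lemma am_half_pi: "am (\<i> * of_real (pi / 2)) = \<i> * of_real (pi / 2)"
proof -
  have "am (- (\<i> * of_real (pi / 2)) + \<i> * of_real pi) = am (- (\<i> * of_real (pi / 2))) + \<i> * of_real pi"
    unfolding am_def by (subst expsum_add_pi_i[where p = True]) (auto simp: dn_coeff_def)
  moreover have "- (\<i> * of_real (pi / 2)) + \<i> * of_real pi = \<i> * of_real (pi / 2)"
    by (simp add: field_simps)
  ultimately show ?thesis by (simp add: am_minus field_simps)
qed

text \<open>The logarithmic derivative of \<open>cn + sn\<close> is \<open>dn\<close>, the
  derivative of \<open>am\<close>. The even and odd parts then express \<open>cn\<close> and
  \<open>sn\<close> through \<open>cosh\<close> and \<open>sinh\<close> of the amplitude.\<close>

lemma cn_plus_sn:
  assumes "\<bar>Re z\<bar> < h"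
  shows "cn z + sn z = cn 0 * exp (am z)"
proof -
  have "((\<lambda>z. (cn z + sn z) * exp (- am z)) has_field_derivative 0) (at z)" if "\<bar>Re z\<bar> < h" for z
    by (rule derivative_eq_intros cn_has_derivative[OF that] sn_has_derivative[OF that] am_has_derivative[OF that] refl)+
       (simp add: algebra_simps)
  from strip_constant[OF this assms] show ?thesis by (simp add: exp_minus field_simps)
qed

lemma cn_eq_cosh_am: "\<bar>Re z\<bar> < h \<Longrightarrow> cn z = cn 0 * cosh (am z)"
  and sn_eq_sinh_am: "\<bar>Re z\<bar> < h \<Longrightarrow> sn z = cn 0 * sinh (am z)"
proof -
  assume z: "\<bar>Re z\<bar> < h"
  have 1: "cn z + sn z = cn 0 * exp (am z)" by (rule cn_plus_sn[OF z])
  have 2: "cn z - sn z = cn 0 * exp (- am z)" using cn_plus_sn[of "- z"] z by (simp add: am_minus)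
  show "cn z = cn 0 * cosh (am z)"
    using arg_cong2[where f = "(+)", OF 1 2] by (simp add: cosh_def scaleR_conv_of_real field_simps)
  show "sn z = cn 0 * sinh (am z)"
    using arg_cong2[where f = "(-)", OF 1 2] by (simp add: sinh_def scaleR_conv_of_real field_simps)
qed

text \<open>The logarithmic derivative of \<open>dn + cn\<close> is \<open>sn\<close>, and
  \<open>\<sigma>\<close> is the termwise antiderivative of \<open>sn\<close>. Its symmetries make
  it real on the imaginary axis, which yields the positivity of \<open>dn + cn\<close> there, and
  from it \<open>c0 < d0\<close> and the positivity of \<open>dn\<close>.\<close>

lemma dn_plus_cn:
  obtains \<sigma> where "\<And>z. \<bar>Re z\<bar> < h \<Longrightarrow> dn z + cn z = (dn 0 + cn 0) * exp (\<sigma> z - \<sigma> 0)" "\<And>z. \<sigma> (- z) = \<sigma> z" "\<And>z. \<sigma> (cnj z) = cnj (\<sigma> z)"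
proof -
  define \<sigma> where "\<sigma> = expsum (\<lambda>j. sn_coeff j / of_int j)"
  have strip: "strip_coeffs h (\<lambda>j. sn_coeff j / of_int j)"
    by (rule strip_coeffs_bounded_mult[OF strip_coeffs_sn norm_divide_of_int_le])
  have eq: "(\<lambda>j. of_int j * (sn_coeff j / of_int j)) = sn_coeff"
    by (auto simp: sn_coeff_def)
  have der: "(\<sigma> has_field_derivative sn z) (at z)" if "\<bar>Re z\<bar> < h" for z
    unfolding \<sigma>_def sn_def using expsum_has_field_derivative[OF strip that] unfolding eq .
  show ?thesis
  proof (rule that[of \<sigma>])
    fix z assume z: "\<bar>Re z\<bar> < h"
    have "((\<lambda>z. (dn z + cn z) * exp (- \<sigma> z)) has_field_derivative 0) (at z)" if "\<bar>Re z\<bar> < h" for z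
      by (rule derivative_eq_intros cn_has_derivative[OF that] dn_has_derivative[OF that] der[OF that] refl)+
         (simp add: algebra_simps)
    from strip_constant[OF this z] show "dn z + cn z = (dn 0 + cn 0) * exp (\<sigma> z - \<sigma> 0)"
      by (simp add: exp_minus exp_diff field_simps)
  next
    show "\<sigma> (- z) = \<sigma> z" for z
      unfolding \<sigma>_def expsum_reflect[symmetric]
      by (rule arg_cong2[where f = expsum]) (auto simp: sn_coeff_def)
    show "\<sigma> (cnj z) = cnj (\<sigma> z)" for z
      unfolding \<sigma>_def by (rule expsum_cnj) (simp add: sn_coeff_def)
  qed
qed

end

section \<open>The complete elliptic integral\<close>

text \<open>\<open>c\<close> times the inverse of \<open>g\<close> is an antiderivative of
  \<open>f\<close> on the open interval and continuous on the closed one. This suffices for the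
  fundamental theorem even if \<open>f\<close> is unbounded at an endpoint, as the elliptic
  integrand is.\<close>

lemma has_integral_constant_pullback:
  fixes f g g' :: "real \<Rightarrow> real"
  assumes "a < b" and cont: "continuous_on {a..b} g"
    and g': "\<And>x. a < x \<Longrightarrow> x < b \<Longrightarrow> (g has_real_derivative g' x) (at x)"
    and pos: "\<And>x. a < x \<Longrightarrow> x < b \<Longrightarrow> g' x > 0"
    and f: "\<And>x. a < x \<Longrightarrow> x < b \<Longrightarrow> f (g x) * g' x = c"
  shows "(f has_integral c * (b - a)) {g a..g b}"
proof -
  have mono: "g x < g y" if "a \<le> x" "x < y" "y \<le> b" for x y
  proof (rule DERIV_pos_imp_increasing_open[OF \<open>x < y\<close>])
    show "continuous_on {x..y} g" using cont that by (auto intro: continuous_on_subset)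
  qed (use that g' pos in force)
  hence inj: "inj_on g {a..b}"
    by (smt (verit) atLeastAtMost_iff inj_onI)
  have img: "g ` {a..b} = {g a..g b}"
  proof
    show "g ` {a..b} \<subseteq> {g a..g b}" using mono \<open>a < b\<close> by (force simp: le_less)
    show "{g a..g b} \<subseteq> g ` {a..b}" using IVT'[of g a _ b] cont \<open>a < b\<close> by (force simp: image_iff)
  qed
  define k where "k = the_inv_into {a..b} g"
  have kg: "k (g x) = x" if "x \<in> {a..b}" for x
    unfolding k_def using inj that by (rule the_inv_into_f_f)
  have gk: "g (k y) = y" "k y \<in> {a..b}" if "y \<in> {g a..g b}" for y
  proof -
    have "y \<in> g ` {a..b}" using that img by simp
    thus "g (k y) = y" "k y \<in> {a..b}"
      unfolding k_def by (rule f_the_inv_into_f[OF inj], rule the_inv_into_into[OF inj _ subset_refl])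
  qed
  have cont_k: "continuous_on {g a..g b} k"
    unfolding img[symmetric] by (rule continuous_on_inv[OF cont]) (auto simp: kg)
  have k_der: "(k has_real_derivative inverse (g' (k y))) (at y)" "a < k y" "k y < b" if y: "g a < y" "y < g b" for y
  proof -
    show k: "a < k y" "k y < b"
      using gk[of y] y by (auto simp: less_le)
    show "(k has_real_derivative inverse (g' (k y))) (at y)"
    proof (rule DERIV_inverse_function[where f = g and a = "g a" and b = "g b"])
      show "isCont k y" by (rule continuous_on_interior[OF cont_k]) (use y in auto)
    qed (use g'[OF k] pos[OF k] y gk in auto)
  qed
  have "((\<lambda>y. c * k y) has_real_derivative f y) (at y)" if y: "g a < y" "y < g b" for y
  proof -
    have "f y * g' (k y) = c" using f[OF k_der(2,3)[OF y]] gk[of y] y by simp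
    hence "f y = c * inverse (g' (k y))" using pos[OF k_der(2,3)[OF y]] by (simp add: field_simps)
    thus ?thesis using DERIV_cmult[OF k_der(1)[OF y], of c] by simp
  qed
  hence "(f has_integral c * k (g b) - c * k (g a)) {g a..g b}"
    using mono[of a b] \<open>a < b\<close> cont_k
    by (intro fundamental_theorem_of_calculus_interior continuous_intros)
       (auto simp: has_real_derivative_iff_has_vector_derivative)
  thus ?thesis using kg[of a] kg[of b] \<open>a < b\<close> by (simp add: right_diff_distrib)
qed

abbreviation ellipticK_integrand :: "real \<Rightarrow> real \<Rightarrow> real" where
  "ellipticK_integrand k t \<equiv> 1 / sqrt ((1 - t\<^sup>2) * (1 - k\<^sup>2 * t\<^sup>2))"

lemma one_minus_square_product_pos:
  fixes k t :: real
  assumes "0 \<le> k" "k < 1" "0 \<le> t" "t \<le> 1"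
  shows "1 - k\<^sup>2 * t\<^sup>2 > 0"
proof -
  have "k\<^sup>2 * t\<^sup>2 \<le> k\<^sup>2 * 1" using assms by (intro mult_left_mono) (auto simp: power_le_one)
  also have "\<dots> < 1" using assms by (simp add: power_less_one_iff)
  finally show ?thesis by simp
qed

text \<open>A constant multiple of this integrand dominates the one for any
  \<open>0 <= k < 1\<close>, and the value \<open>pi / 2\<close> bounds all
  \<open>ellipticK k\<close> from below.\<close>

lemma ellipticK_integrand_0: "(ellipticK_integrand 0 has_integral pi / 2) {0..1}"
proof -
  have "(ellipticK_integrand 0 has_integral 1 * (pi / 2 - 0)) {sin 0..sin (pi / 2)}"
  proof (rule has_integral_constant_pullback)
    fix x :: real assume x: "0 < x" "x < pi / 2"
    show "(sin has_real_derivative cos x) (at x)" by (rule DERIV_sin)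
    show pos: "cos x > 0" using x by (intro cos_gt_zero_pi) auto
    have "1 - (sin x)\<^sup>2 = (cos x)\<^sup>2" by (simp add: cos_squared_eq)
    thus "ellipticK_integrand 0 (sin x) * cos x = 1" using pos by simp
  qed (auto intro!: continuous_intros)
  thus ?thesis by simp
qed

lemma ellipticK_integrable:
  assumes "0 \<le> k" "k < 1"
  shows "ellipticK_integrand k integrable_on {0..1}"
proof (rule measurable_bounded_by_integrable_imp_integrable)
  show "ellipticK_integrand k \<in> borel_measurable (lebesgue_on {0..1})"
    by (rule measurable_restrict_space1[OF measurable_completion]) measurable
  show "(\<lambda>t. 1 / sqrt (1 - k\<^sup>2) * ellipticK_integrand 0 t) integrable_on {0..1}"
    by (rule has_integral_integrable[OF has_integral_mult_right[OF ellipticK_integrand_0]])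
  fix t :: real assume "t \<in> {0..1}"
  hence t: "0 \<le> t" "t \<le> 1" by auto
  have "k\<^sup>2 < 1" using assms by (simp add: power_less_one_iff)
  have "t\<^sup>2 \<le> 1" using t by (simp add: power_le_one)
  have "k\<^sup>2 * t\<^sup>2 \<le> k\<^sup>2 * 1" using \<open>t\<^sup>2 \<le> 1\<close> by (intro mult_left_mono) auto
  hence "sqrt (1 - k\<^sup>2) \<le> sqrt (1 - k\<^sup>2 * t\<^sup>2)" by simp
  moreover have "sqrt (1 - k\<^sup>2) > 0" using \<open>k\<^sup>2 < 1\<close> by simp
  ultimately have "1 / sqrt (1 - k\<^sup>2 * t\<^sup>2) \<le> 1 / sqrt (1 - k\<^sup>2)"
    by (intro divide_left_mono mult_pos_pos) auto
  hence "1 / sqrt (1 - t\<^sup>2) * (1 / sqrt (1 - k\<^sup>2 * t\<^sup>2)) \<le> 1 / sqrt (1 - t\<^sup>2) * (1 / sqrt (1 - k\<^sup>2))"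
    using \<open>t\<^sup>2 \<le> 1\<close> by (intro mult_left_mono) auto
  moreover have "0 \<le> 1 - k\<^sup>2 * t\<^sup>2" using one_minus_square_product_pos[OF assms t] by simp
  ultimately show "norm (ellipticK_integrand k t) \<le> 1 / sqrt (1 - k\<^sup>2) * ellipticK_integrand 0 t"
    using \<open>t\<^sup>2 \<le> 1\<close> by (simp add: real_sqrt_mult mult.commute)
qed auto

lemma ellipticK_strict_mono:
  assumes "0 \<le> k" "k < l" "l < 1"
  shows "ellipticK k < ellipticK l"
proof -
  have less: "ellipticK_integrand k t < ellipticK_integrand l t" if t: "t \<in> {0<..<1}" for t
  proof -
    have "k\<^sup>2 < l\<^sup>2" using assms by (intro power_strict_mono) auto
    hence "k\<^sup>2 * t\<^sup>2 < l\<^sup>2 * t\<^sup>2" using t by simp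
    moreover have "1 - l\<^sup>2 * t\<^sup>2 > 0" using assms t by (intro one_minus_square_product_pos) auto
    moreover have "1 - t\<^sup>2 > 0" using t by (simp add: power_less_one_iff)
    ultimately show ?thesis
      by (intro divide_strict_left_mono real_sqrt_less_mono mult_strict_left_mono mult_pos_pos iffD2[OF real_sqrt_gt_0_iff]) auto
  qed
  \<comment> \<open>At the endpoints the integrands agree: both are 1 at \<open>t = 0\<close>, and
    both are \<open>1 / 0 = 0\<close> at \<open>t = 1\<close>.\<close>
  have le: "ellipticK_integrand k t \<le> ellipticK_integrand l t" if "t \<in> {0..1}" for t
    using less[of t] that by (cases "t = 0 \<or> t = 1") (auto simp: less_le)
  have int: "ellipticK_integrand k integrable_on {0..1}" "ellipticK_integrand l integrable_on {0..1}"
    using assms by (auto intro: ellipticK_integrable)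
  have "ellipticK k \<le> ellipticK l"
    unfolding ellipticK_def using int le by (intro integral_le) auto
  moreover have "ellipticK k \<noteq> ellipticK l"
  proof
    assume eq: "ellipticK k = ellipticK l"
    let ?d = "\<lambda>t. ellipticK_integrand l t - ellipticK_integrand k t"
    have d: "?d integrable_on {0..1}" using int by (intro integrable_diff)
    \<comment> \<open>If the integrals were equal, the nonnegative difference would have integral 0
      on the left half. It is continuous there, away from the singularity at 1, so it would vanish
      at \<open>1/2\<close>.\<close>
    have "integral {0..1/2} ?d \<le> integral {0..1} ?d"
      using d le by (intro integral_subset_le integrable_on_subinterval[OF d]) auto
    also have "\<dots> = 0"
      using eq int by (simp add: integral_diff ellipticK_def)
    finally have "integral {0..1/2} ?d \<le> 0" .
    moreover have "integral {0..1/2} ?d \<ge> 0"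
      by (intro integral_nonneg integrable_on_subinterval[OF d]) (use le in auto)
    ultimately have "(?d has_integral 0) (cbox 0 (1/2))"
      using integrable_integral[OF integrable_on_subinterval[OF d, of 0 "1/2"]] by simp
    moreover have "continuous_on (cbox 0 (1/2)) (ellipticK_integrand m)" if m: "0 \<le> m" "m < 1" for m
    proof (intro continuous_on_divide continuous_on_const continuous_intros ballI)
      fix t :: real assume "t \<in> cbox 0 (1/2)"
      hence "(1 - t\<^sup>2) * (1 - m\<^sup>2 * t\<^sup>2) > 0"
        using m one_minus_square_product_pos[of m t] by (intro mult_pos_pos) (auto simp: power_less_one_iff)
      thus "sqrt ((1 - t\<^sup>2) * (1 - m\<^sup>2 * t\<^sup>2)) \<noteq> 0"
        using real_sqrt_eq_0_iff less_irrefl by metis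
    qed
    hence "continuous_on (cbox 0 (1/2)) ?d"
      using assms by (intro continuous_on_diff) auto
    ultimately have "?d (1/2) = 0"
      using le by (intro has_integral_0_cbox_imp_0[of 0 "1/2" ?d]) auto
    with less[of "1/2"] show False by simp
  qed
  ultimately show ?thesis by simp
qed

lemma ellipticK_pos:
  assumes "0 \<le> k" "k < 1"
  shows "ellipticK k > 0"
proof -
  have "ellipticK 0 = pi / 2" unfolding ellipticK_def using ellipticK_integrand_0 by (rule integral_unique)
  moreover have "ellipticK 0 \<le> ellipticK k"
    using ellipticK_strict_mono[of 0 k] assms by (cases "k = 0") auto
  ultimately show ?thesis using pi_gt_zero by linarith
qed

lemma ellipticK_ratio_inj:
  assumes "0 < k" "k < 1" "0 < l" "l < 1"
    and eq: "ellipticK (sqrt (1 - k\<^sup>2)) / ellipticK k = ellipticK (sqrt (1 - l\<^sup>2)) / ellipticK l"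
  shows "k = l"
proof -
  have *: "ellipticK (sqrt (1 - l\<^sup>2)) / ellipticK l < ellipticK (sqrt (1 - k\<^sup>2)) / ellipticK k"
    if "0 < k" "k < l" "l < 1" for k l :: real
  proof -
    have "k\<^sup>2 < l\<^sup>2" using that by (intro power_strict_mono) auto
    moreover have "k\<^sup>2 > 0" "l\<^sup>2 < 1" using that by (auto simp: power_less_one_iff)
    ultimately have "ellipticK (sqrt (1 - l\<^sup>2)) < ellipticK (sqrt (1 - k\<^sup>2))"
      by (intro ellipticK_strict_mono) auto
    moreover have "ellipticK k < ellipticK l" "ellipticK k > 0"
      using that by (auto intro: ellipticK_strict_mono ellipticK_pos)
    moreover have "ellipticK (sqrt (1 - l\<^sup>2)) > 0"
      using \<open>l\<^sup>2 < 1\<close> that by (intro ellipticK_pos) auto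
    ultimately show ?thesis by (intro frac_less) auto
  qed
  show ?thesis using *[of k l] *[of l k] eq assms by force
qed

section \<open>Quarter periods\<close>

lemma has_real_derivative_Im_imag_axis:
  assumes "(f has_field_derivative f') (at (\<i> * of_real t))"
  shows "((\<lambda>t. Im (f (\<i> * of_real t))) has_real_derivative Re f') (at t)"
proof -
  have "((\<lambda>t. \<i> * complex_of_real t) has_vector_derivative \<i> * of_real 1) (at t)"
    by (intro has_vector_derivative_mult_right has_vector_derivative_of_real) (auto intro: derivative_eq_intros)
  from field_vector_diff_chain_at[OF this assms]
  have "((\<lambda>t. f (\<i> * of_real t)) has_vector_derivative \<i> * of_real 1 * f') (at t)"
    by (simp add: o_def)
  from bounded_linear.has_vector_derivative[OF bounded_linear_Im this] show ?thesis
    by (simp add: has_real_derivative_iff_has_vector_derivative)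
qed

lemma has_real_derivative_Re_real_axis:
  assumes "(f has_field_derivative f') (at (of_real t))"
  shows "((\<lambda>t. Re (f (of_real t))) has_real_derivative Re f') (at t)"
proof -
  have "((\<lambda>t. complex_of_real t) has_vector_derivative of_real 1) (at t)"
    by (intro has_vector_derivative_of_real) (auto intro: derivative_eq_intros)
  from field_vector_diff_chain_at[OF this assms]
  have "((\<lambda>t. f (of_real t)) has_vector_derivative of_real 1 * f') (at t)"
    by (simp add: o_def)
  from bounded_linear.has_vector_derivative[OF bounded_linear_Re this] show ?thesis
    by (simp add: has_real_derivative_iff_has_vector_derivative)
qed

lemma expsum_real_ge_partial_sum:
  assumes a: "strip_coeffs h a" "\<And>j. a j = of_real (\<alpha> j)" "\<And>j. \<alpha> j \<ge> 0"
    and y: "\<bar>y\<bar> < h" and F: "finite F"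
  shows "(\<Sum>j\<in>F. \<alpha> j * exp (of_int j * y)) \<le> Re (expsum a (of_real y))"
proof (rule finite_sum_le_has_sum)
  have "((\<lambda>j. Re (a j * exp (of_int j * of_real y))) has_sum Re (expsum a (of_real y))) UNIV"
    by (intro has_sum_Re expsum_has_sum[OF a(1)]) (use y in simp)
  moreover have "Re (a j * exp (of_int j * of_real y)) = \<alpha> j * exp (of_int j * y)" for j
    by (simp add: a(2) Re_exp)
  ultimately show "((\<lambda>j. \<alpha> j * exp (of_int j * y)) has_sum Re (expsum a (of_real y))) UNIV"
    by simp
qed (use F a(3) in auto)

lemma eq_of_real_Re: "cnj w = w \<Longrightarrow> w = of_real (Re w)"
  by (simp add: complex_eq_iff)

context nome_parameter
begin

definition c0 :: real where "c0 = Re (cn 0)"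
definition d0 :: real where "d0 = Re (dn 0)"
definition cnr :: "real \<Rightarrow> real" where "cnr y = Re (cn (of_real y))"
definition snr :: "real \<Rightarrow> real" where "snr y = Re (sn (of_real y))"
definition dnr :: "real \<Rightarrow> real" where "dnr y = Re (dn (of_real y))"

lemma cn_of_real: "cn (of_real y) = of_real (cnr y)"
  and sn_of_real: "sn (of_real y) = of_real (snr y)"
  and dn_of_real: "dn (of_real y) = of_real (dnr y)"
  unfolding cnr_def snr_def dnr_def
  by (rule eq_of_real_Re; simp flip: cn_cnj sn_cnj dn_cnj)+

lemma cn_0: "cn 0 = of_real c0" and dn_0: "dn 0 = of_real d0"
  using cn_of_real[of 0] dn_of_real[of 0] by (simp_all add: c0_def d0_def cnr_def dnr_def)

lemma cnr_0 [simp]: "cnr 0 = c0" and snr_0 [simp]: "snr 0 = 0" and dnr_0 [simp]: "dnr 0 = d0"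
  by (simp_all add: c0_def d0_def cnr_def snr_def dnr_def)

lemma cnr_lower_bound:
  assumes "\<bar>y\<bar> < h" "finite F" "\<And>j. j \<in> F \<Longrightarrow> odd j"
  shows "(\<Sum>j\<in>F. exp (of_int j * y) / cosh (of_int j * h)) \<le> cnr y"
proof -
  have "(\<Sum>j\<in>F. (if odd j then 1 / cosh (of_int j * h) else 0) * exp (of_int j * y)) \<le> cnr y"
    unfolding cnr_def cn_def
    by (rule expsum_real_ge_partial_sum[OF strip_coeffs_cn]) (use assms in \<open>auto simp: cn_coeff_def\<close>)
  moreover have "(\<Sum>j\<in>F. (if odd j then 1 / cosh (of_int j * h) else 0) * exp (of_int j * y)) = (\<Sum>j\<in>F. exp (of_int j * y) / cosh (of_int j * h))"
    using assms by (intro sum.cong) auto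
  ultimately show ?thesis by simp
qed

lemma cnr_pos: "\<bar>y\<bar> < h \<Longrightarrow> cnr y > 0"
  using cnr_lower_bound[of y "{1}"] by (simp add: less_le_trans[rotated])

lemma dnr_pos:
  assumes "\<bar>y\<bar> < h"
  shows "dnr y > 0"
proof -
  have "(\<Sum>j\<in>{0}. (if even j then 1 / cosh (of_int j * h) else 0) * exp (of_int j * y)) \<le> dnr y"
    unfolding dnr_def dn_def
    by (rule expsum_real_ge_partial_sum[OF strip_coeffs_dn]) (use assms in \<open>auto simp: dn_coeff_def\<close>)
  thus ?thesis by simp
qed

lemma c0_pos: "c0 > 0" and d0_pos: "d0 > 0"
  using cnr_pos[of 0] dnr_pos[of 0] h_pos by simp_all

lemma cnr_snr_sq: "\<bar>y\<bar> < h \<Longrightarrow> cnr y ^ 2 - snr y ^ 2 = c0 ^ 2"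
  and dnr_snr_sq: "\<bar>y\<bar> < h \<Longrightarrow> dnr y ^ 2 - snr y ^ 2 = d0 ^ 2"
  using cn_sn_sq[of "of_real y"] dn_sn_sq[of "of_real y"]
  by (simp_all add: cn_of_real sn_of_real dn_of_real cn_0 dn_0 flip: of_real_power of_real_diff)

lemma cnr_has_derivative: "\<bar>y\<bar> < h \<Longrightarrow> (cnr has_real_derivative snr y * dnr y) (at y)"
  and snr_has_derivative: "\<bar>y\<bar> < h \<Longrightarrow> (snr has_real_derivative cnr y * dnr y) (at y)"
proof -
  assume "\<bar>y\<bar> < h"
  hence strip: "\<bar>Re (of_real y)\<bar> < h" by simp
  have 1: "Re (sn (of_real y) * dn (of_real y)) = snr y * dnr y" "Re (cn (of_real y) * dn (of_real y)) = cnr y * dnr y"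
    unfolding cn_of_real sn_of_real dn_of_real by simp_all
  show "(cnr has_real_derivative snr y * dnr y) (at y)" "(snr has_real_derivative cnr y * dnr y) (at y)"
    using has_real_derivative_Re_real_axis[OF cn_has_derivative[OF strip]]
      has_real_derivative_Re_real_axis[OF sn_has_derivative[OF strip]]
    unfolding 1 cnr_def[abs_def, symmetric] snr_def[abs_def, symmetric] .
qed

text \<open>At \<open>y = h\<close> the terms with positive odd \<open>j\<close> do not tend to 0.
  Once \<open>h - y < 1 / (2 N)\<close>, each of the first \<open>N\<close> of them is at least
  \<open>exp (- 1)\<close>, and all other terms are nonnegative.\<close>

lemma filterlim_cnr: "filterlim cnr at_top (at_left h)"
  unfolding filterlim_at_top
proof
  fix B :: real
  obtain N :: nat where N: "real N > \<bar>B\<bar> * exp 1" using reals_Archimedean2 by blast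
  hence "N > 0" by (metis abs_ge_zero exp_ge_zero gr0I mult_nonneg_nonneg not_less of_nat_0)
  \<comment> \<open>The minimum with \<open>h\<close> keeps \<open>y\<close> positive, hence inside
    the strip.\<close>
  define \<delta> where "\<delta> = min h (1 / (2 * real N))"
  have "\<delta> > 0" using \<open>N > 0\<close> h_pos by (simp add: \<delta>_def)
  have "B \<le> cnr y" if y: "y \<in> {h - \<delta><..<h}" for y
  proof -
    have y': "\<bar>y\<bar> < h" "0 < h - y" "h - y < 1 / (2 * real N)" using y by (auto simp: \<delta>_def)
    have inj: "inj_on (\<lambda>i. 2 * int i + 1) {..<N}" by (auto simp: inj_on_def)
    have "exp (- 1) \<le> exp (of_int (2 * int i + 1) * y) / cosh (of_int (2 * int i + 1) * h)" if "i < N" for i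
    proof -
      define m where "m = real_of_int (2 * int i + 1)"
      have m: "m > 0" "m \<le> 2 * real N" using that by (auto simp: m_def)
      have "m * (h - y) \<le> 2 * real N * (1 / (2 * real N))"
        using m y' by (intro mult_mono) auto
      hence "exp (- 1) \<le> exp (m * y) / exp (m * h)"
        using \<open>N > 0\<close> by (simp add: exp_diff[symmetric] algebra_simps)
      also have "cosh (m * h) \<le> exp (m * h)" using m h_pos by (simp add: cosh_def)
      hence "exp (m * y) / exp (m * h) \<le> exp (m * y) / cosh (m * h)"
        by (intro divide_left_mono mult_pos_pos) auto
      finally show ?thesis by (simp add: m_def)
    qed
    hence "(\<Sum>i<N. exp (- 1)) \<le> (\<Sum>i<N. exp (of_int (2 * int i + 1) * y) / cosh (of_int (2 * int i + 1) * h))"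
      by (intro sum_mono) auto
    also have "\<dots> = (\<Sum>j\<in>(\<lambda>i. 2 * int i + 1) ` {..<N}. exp (of_int j * y) / cosh (of_int j * h))"
      by (subst sum.reindex[OF inj]) (simp add: o_def)
    also have "\<dots> \<le> cnr y"
      using y' by (intro cnr_lower_bound) auto
    finally have "real N * exp (- 1) \<le> cnr y" by simp
    moreover have "B * exp 1 \<le> \<bar>B\<bar> * exp 1" by (intro mult_right_mono) auto
    hence "B * exp 1 \<le> real N" using N by linarith
    hence "B \<le> real N * exp (- 1)" by (simp add: exp_minus field_simps)
    ultimately show ?thesis by linarith
  qed
  thus "eventually (\<lambda>y. B \<le> cnr y) (at_left h)"
    using \<open>\<delta> > 0\<close> by (intro eventually_at_leftI[of "h - \<delta>"]) auto
qed

lemma snr_pos: "0 < y \<Longrightarrow> y < h \<Longrightarrow> snr y > 0"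
proof -
  assume y: "0 < y" "y < h"
  have "snr 0 < snr y"
  proof (rule DERIV_pos_imp_increasing[OF y(1)])
    fix x assume "0 \<le> x" "x \<le> y"
    hence "\<bar>x\<bar> < h" using y by simp
    thus "\<exists>d. (snr has_real_derivative d) (at x) \<and> d > 0"
      using snr_has_derivative[of x] cnr_pos[of x] dnr_pos[of x] by (auto intro!: exI mult_pos_pos)
  qed
  thus ?thesis by simp
qed

text \<open>The squared quotient is \<open>1 - c0^2 / cnr^2\<close>, and \<open>cnr\<close> tends to
  infinity; positivity of both functions selects the square root.\<close>

lemma tendsto_snr_div_cnr: "((\<lambda>y. snr y / cnr y) \<longlongrightarrow> 1) (at_left h)"
proof -
  have "((\<lambda>y. c0\<^sup>2 / cnr y ^ 2) \<longlongrightarrow> 0) (at_left h)"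
    by (rule real_tendsto_divide_at_top[OF tendsto_const filterlim_pow_at_top[OF _ filterlim_cnr]]) simp
  hence "((\<lambda>y. sqrt (1 - c0\<^sup>2 / cnr y ^ 2)) \<longlongrightarrow> sqrt (1 - 0)) (at_left h)"
    by (intro tendsto_intros)
  moreover have "eventually (\<lambda>y. sqrt (1 - c0\<^sup>2 / cnr y ^ 2) = snr y / cnr y) (at_left h)"
  proof (rule eventually_at_leftI[of 0])
    fix y assume y: "y \<in> {0<..<h}"
    hence pos: "cnr y > 0" "snr y > 0" using cnr_pos[of y] snr_pos[of y] by auto
    have "1 - c0\<^sup>2 / cnr y ^ 2 = (snr y / cnr y)\<^sup>2"
      using cnr_snr_sq[of y] y pos by (simp add: field_simps)
    thus "sqrt (1 - c0\<^sup>2 / cnr y ^ 2) = snr y / cnr y" using pos by simp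
  qed (rule h_pos)
  ultimately show ?thesis by (simp add: filterlim_cong)
qed

lemma dn_imag_axis_real: "dn (\<i> * of_real t) = of_real (Re (dn (\<i> * of_real t)))"
  by (rule eq_of_real_Re) (simp flip: dn_cnj)

text \<open>On the imaginary axis conjugation is negation, so the evenness of
  \<open>\<sigma>\<close> makes it real there, and the exponential of a real number is
  positive.\<close>

lemma dn_plus_cn_imag_pos: "Re (dn (\<i> * of_real t)) + Re (cn (\<i> * of_real t)) > 0"
proof -
  obtain \<sigma> where \<sigma>: "\<And>z. \<bar>Re z\<bar> < h \<Longrightarrow> dn z + cn z = (dn 0 + cn 0) * exp (\<sigma> z - \<sigma> 0)"
    "\<And>z. \<sigma> (- z) = \<sigma> z" "\<And>z. \<sigma> (cnj z) = cnj (\<sigma> z)"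
    using dn_plus_cn by blast
  have 1: "\<sigma> (\<i> * of_real t) = of_real (Re (\<sigma> (\<i> * of_real t)))" "\<sigma> 0 = of_real (Re (\<sigma> 0))"
    by (rule eq_of_real_Re; simp add: \<sigma>(2) flip: \<sigma>(3))+
  have exp: "exp (\<sigma> (\<i> * of_real t) - \<sigma> 0) = of_real (exp (Re (\<sigma> (\<i> * of_real t)) - Re (\<sigma> 0)))"
    by (subst 1(1), subst 1(2)) (simp only: of_real_diff[symmetric] exp_of_real)
  have "dn (\<i> * of_real t) + cn (\<i> * of_real t) =
      of_real ((d0 + c0) * exp (Re (\<sigma> (\<i> * of_real t)) - Re (\<sigma> 0)))"
    using \<sigma>(1)[of "\<i> * of_real t"] h_pos exp by (simp add: cn_0 dn_0)
  from arg_cong[OF this, of Re] show ?thesis using c0_pos d0_pos by simp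
qed

lemma cn_add_pi_i: "cn (z + \<i> * of_real pi) = - cn z"
  unfolding cn_def by (subst expsum_add_pi_i[where p = False]) (auto simp: cn_coeff_def)

lemma dn_add_pi_i: "dn (z + \<i> * of_real pi) = dn z"
  unfolding dn_def by (subst expsum_add_pi_i[where p = True]) (auto simp: dn_coeff_def)

text \<open>Translation by \<open>i pi\<close> keeps \<open>dn\<close> and changes the sign of
  \<open>cn\<close>.\<close>

lemma dn_minus_cn_imag_pos: "Re (dn (\<i> * of_real t)) - Re (cn (\<i> * of_real t)) > 0"
  using dn_plus_cn_imag_pos[of "t + pi"] cn_add_pi_i[of "\<i> * of_real t"] dn_add_pi_i[of "\<i> * of_real t"]
  by (simp add: ring_distribs)

lemma c0_less_d0: "c0 < d0"
  using dn_minus_cn_imag_pos[of 0] by (simp add: c0_def d0_def)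

lemma dn_imag_pos: "Re (dn (\<i> * of_real t)) > 0"
  using dn_minus_cn_imag_pos[of t] dn_plus_cn_imag_pos[of t] by linarith

lemma ellipticK_modulus: "ellipticK (c0 / d0) = d0 * (pi / 2)"
proof -
  define \<phi> where "\<phi> t = Im (am (\<i> * of_real t))" for t
  define D where "D t = Re (dn (\<i> * of_real t))" for t
  have strip: "\<bar>Re (\<i> * of_real t)\<bar> < h" for t using h_pos by simp
  have am: "am (\<i> * of_real t) = \<i> * of_real (\<phi> t)" for t
  proof -
    have "cnj (expsum (\<lambda>j. dn_coeff j / of_int j) z) = expsum (\<lambda>j. dn_coeff j / of_int j) (cnj z)" for z
      by (rule expsum_cnj[symmetric]) (simp add: dn_coeff_def)
    hence "cnj (am z) = am (cnj z)" for z by (simp add: am_def)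
    from this[of "\<i> * of_real t"] have "cnj (am (\<i> * of_real t)) = - am (\<i> * of_real t)"
      by (simp add: am_minus)
    thus ?thesis by (simp add: \<phi>_def complex_eq_iff)
  qed
  have \<phi>_der: "(\<phi> has_real_derivative D t) (at t)" for t
    unfolding \<phi>_def[abs_def] D_def
    by (rule has_real_derivative_Im_imag_axis[OF am_has_derivative[OF strip]])
  have \<phi>_less: "\<phi> s < \<phi> t" if "s < t" for s t
    by (rule DERIV_pos_imp_increasing[OF that]) (use \<phi>_der dn_imag_pos D_def in metis)
  have \<phi>_ends: "\<phi> 0 = 0" "\<phi> (pi / 2) = pi / 2"
    unfolding \<phi>_def am_half_pi by simp_all
  \<comment> \<open>The first integral of \<open>dn\<close> and \<open>sn\<close> on the imaginary
    axis: \<open>\<phi>\<close> solves the pendulum equation whose speed is \<open>d0\<close> times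
    the second root of the elliptic integrand.\<close>
  have D_sq: "D t ^ 2 = d0 ^ 2 - c0 ^ 2 * sin (\<phi> t) ^ 2" for t
  proof -
    have "sn (\<i> * of_real t) = of_real c0 * (\<i> * of_real (sin (\<phi> t)))"
      using sn_eq_sinh_am[OF strip, of t] am[of t] by (simp add: cn_0 sinh_conv_sin sin_of_real)
    hence "complex_of_real (D t ^ 2) = of_real (d0 ^ 2 - c0 ^ 2 * sin (\<phi> t) ^ 2)"
      using dn_sn_sq[OF strip, of t] dn_imag_axis_real[of t, folded D_def]
      by (simp add: dn_0 power_mult_distrib algebra_simps)
    thus ?thesis by (simp only: of_real_eq_iff)
  qed
  have "(ellipticK_integrand (c0 / d0) has_integral d0 * (pi / 2 - 0)) {sin (\<phi> 0)..sin (\<phi> (pi / 2))}"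
  proof (rule has_integral_constant_pullback)
    fix t assume t: "0 < t" "t < pi / 2"
    have \<phi>: "0 < \<phi> t" "\<phi> t < pi / 2" using \<phi>_less[OF t(1)] \<phi>_less[OF t(2)] \<phi>_ends by auto
    hence cos: "cos (\<phi> t) > 0" by (intro cos_gt_zero) auto
    have D: "D t > 0" using dn_imag_pos by (simp add: D_def)
    show "((\<lambda>t. sin (\<phi> t)) has_real_derivative cos (\<phi> t) * D t) (at t)"
      by (rule derivative_eq_intros \<phi>_der refl)+
    show "cos (\<phi> t) * D t > 0" using cos D by simp
    have "(1 - (sin (\<phi> t))\<^sup>2) * (1 - (c0 / d0)\<^sup>2 * (sin (\<phi> t))\<^sup>2) = (cos (\<phi> t) * D t / d0)\<^sup>2"
      using d0_pos by (simp add: cos_squared_eq power_mult_distrib power_divide D_sq field_simps)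
    thus "ellipticK_integrand (c0 / d0) (sin (\<phi> t)) * (cos (\<phi> t) * D t) = d0"
      using cos D d0_pos by simp
  next
    show "continuous_on {0..pi/2} (\<lambda>t. sin (\<phi> t))"
      by (intro continuous_intros DERIV_continuous_on[OF has_field_derivative_at_within[OF \<phi>_der]])
  qed auto
  thus ?thesis
    unfolding ellipticK_def using \<phi>_ends by (intro integral_unique) simp
qed

lemma ellipticK_complementary_modulus: "ellipticK (sqrt (1 - (c0 / d0)\<^sup>2)) = d0 * h"
proof -
  define \<kappa>' where "\<kappa>' = sqrt (1 - (c0 / d0)\<^sup>2)"
  have "(c0 / d0)\<^sup>2 \<le> 1" using c0_pos d0_pos c0_less_d0 by (simp add: power_le_one)
  hence \<kappa>': "\<kappa>'\<^sup>2 = 1 - (c0 / d0)\<^sup>2" by (simp add: \<kappa>'_def)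
  \<comment> \<open>Both \<open>snr\<close> and \<open>cnr\<close> blow up at \<open>h\<close>; the
    value 1 is the limit of their quotient and makes \<open>g\<close> continuous up to the
    endpoint.\<close>
  define g where "g y = (if y < h then snr y / cnr y else 1)" for y
  have der: "(g has_real_derivative c0\<^sup>2 * dnr y / cnr y ^ 2) (at y)" if y: "\<bar>y\<bar> < h" for y
  proof -
    have "cnr y * dnr y * cnr y - snr y * (snr y * dnr y) = (cnr y ^ 2 - snr y ^ 2) * dnr y"
      by (simp add: power2_eq_square algebra_simps)
    also have "\<dots> = c0\<^sup>2 * dnr y" using cnr_snr_sq[OF y] by simp
    finally have "((\<lambda>y. snr y / cnr y) has_real_derivative c0\<^sup>2 * dnr y / cnr y ^ 2) (at y)"
      using DERIV_quotient[OF snr_has_derivative[OF y] cnr_has_derivative[OF y]] cnr_pos[OF y]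
      by (simp add: mult.commute power2_eq_square)
    moreover have "eventually (\<lambda>x. x \<in> {..<h}) (nhds y)"
      by (rule eventually_nhds_in_open) (use y in auto)
    hence "eventually (\<lambda>y. g y = snr y / cnr y) (nhds y)"
      by eventually_elim (simp add: g_def)
    ultimately show ?thesis by (simp add: DERIV_cong_ev)
  qed
  have "(ellipticK_integrand \<kappa>' has_integral d0 * (h - 0)) {g 0..g h}"
  proof (rule has_integral_constant_pullback[OF h_pos])
    fix y assume y: "0 < y" "y < h"
    hence y': "\<bar>y\<bar> < h" by simp
    note pos = cnr_pos[OF y'] dnr_pos[OF y'] snr_pos[OF y] c0_pos d0_pos
    show "(g has_real_derivative c0\<^sup>2 * dnr y / cnr y ^ 2) (at y)" by (rule der[OF y'])
    show "c0\<^sup>2 * dnr y / cnr y ^ 2 > 0" using pos by simp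
    have 1: "1 - (g y)\<^sup>2 = (c0 / cnr y)\<^sup>2"
      using cnr_snr_sq[OF y'] pos y by (simp add: g_def field_simps)
    have "1 - \<kappa>'\<^sup>2 * (g y)\<^sup>2 = (cnr y ^ 2 - snr y ^ 2 + (c0 / d0)\<^sup>2 * snr y ^ 2) / cnr y ^ 2"
      using pos y by (simp add: g_def \<kappa>' power_divide field_simps)
    \<comment> \<open>The first two squares combine to \<open>c0^2\<close>; factoring out
      \<open>(c0 / d0)^2\<close> leaves \<open>d0^2 + snr^2 = dnr^2\<close>.\<close>
    also have "cnr y ^ 2 - snr y ^ 2 + (c0 / d0)\<^sup>2 * snr y ^ 2 = (c0 * dnr y / d0)\<^sup>2"
      using dnr_snr_sq[OF y'] cnr_snr_sq[OF y'] pos 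
      by (simp add: power_divide power_mult_distrib field_simps)
    finally have 2: "1 - \<kappa>'\<^sup>2 * (g y)\<^sup>2 = (c0 * dnr y / d0 / cnr y)\<^sup>2"
      by (simp add: power_divide power_mult_distrib)
    have "sqrt ((1 - (g y)\<^sup>2) * (1 - \<kappa>'\<^sup>2 * (g y)\<^sup>2)) = (c0 / cnr y) * (c0 * dnr y / d0 / cnr y)"
      unfolding 1 2 using pos by (simp add: real_sqrt_mult)
    thus "ellipticK_integrand \<kappa>' (g y) * (c0\<^sup>2 * dnr y / cnr y ^ 2) = d0"
      using pos by (simp add: power2_eq_square)
  next
    show "continuous_on {0..h} g"
      unfolding continuous_on_eq_continuous_within
    proof
      fix x assume x: "x \<in> {0..h}"
      show "continuous (at x within {0..h}) g"
      proof (cases "x < h")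
        case True
        thus ?thesis using der[of x] x by (auto intro!: continuous_at_imp_continuous_at_within DERIV_isCont)
      next
        case False
        hence "x = h" using x by simp
        have "eventually (\<lambda>y. snr y / cnr y = g y) (at_left h)"
          by (rule eventually_at_leftI[of 0]) (use h_pos in \<open>auto simp: g_def\<close>)
        hence "(g \<longlongrightarrow> 1) (at_left h)"
          using tendsto_snr_div_cnr by (rule Lim_transform_eventually[rotated])
        thus ?thesis using h_pos \<open>x = h\<close>
          by (simp add: continuous_within at_within_Icc_at_left g_def)
      qed
    qed
  qed
  moreover have "g 0 = 0" "g h = 1" using h_pos by (auto simp: g_def)
  ultimately show ?thesis
    unfolding ellipticK_def \<kappa>'_def[symmetric] by (intro integral_unique) simp
qed

end

section \<open>Taylor coefficients and Lambert series\<close>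

lemma has_field_derivative_unique_on_open:
  assumes "open U" "z \<in> U" "\<And>w. w \<in> U \<Longrightarrow> f w = g w"
    and "(f has_field_derivative f') (at z)" "(g has_field_derivative g') (at z)"
  shows "f' = g'"
  using DERIV_unique[OF has_field_derivative_transform_within_open[OF assms(4,1,2)] assms(5)] assms(3) by blast

text \<open>All Jacobian elliptic functions satisfy a differential equation of this form.\<close>
lemma fourth_derivative_cubic_ode:
  fixes y :: "'a :: real_normed_field \<Rightarrow> 'a"
  assumes U: "open U" "x \<in> U"
    and y: "\<And>z. z \<in> U \<Longrightarrow> (y has_field_derivative y1 z) (at z)"
    and y1: "\<And>z. z \<in> U \<Longrightarrow> (y1 has_field_derivative y2 z) (at z)"
    and y2: "\<And>z. z \<in> U \<Longrightarrow> (y2 has_field_derivative y3 z) (at z)"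
    and y3: "(y3 has_field_derivative y4) (at x)"
    and ode: "\<And>z. z \<in> U \<Longrightarrow> y2 z = 2 * y z ^ 3 + a * y z"
    and crit: "y1 x = 0"
  shows "y4 = (6 * y x ^ 2 + a) * y2 x"
proof -
  have y3_eq: "y3 z = (6 * y z ^ 2 + a) * y1 z" if z: "z \<in> U" for z
  proof (rule has_field_derivative_unique_on_open[OF U(1) z ode y2[OF z]])
    show "((\<lambda>z. 2 * y z ^ 3 + a * y z) has_field_derivative (6 * y z ^ 2 + a) * y1 z) (at z)"
      by (rule derivative_eq_intros y[OF z] refl)+ (simp add: algebra_simps)
  qed
  show ?thesis
  proof (rule has_field_derivative_unique_on_open[OF U y3_eq y3])
    \<comment> \<open>The product rule also yields \<open>12 * y x * y1 x ^ 2\<close>, which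
      vanishes at the critical point.\<close>
    show "((\<lambda>z. (6 * y z ^ 2 + a) * y1 z) has_field_derivative (6 * y x ^ 2 + a) * y2 x) (at x)"
      by (rule derivative_eq_intros y[OF U(2)] y1[OF U(2)] refl)+ (simp add: crit)
  qed
qed

lemma has_sum_int_symmetric:
  fixes f :: "int \<Rightarrow> complex"
  assumes f: "(f has_sum S) UNIV" and sym: "\<And>j. f (- j) = f j"
  shows "((\<lambda>n. f (int n)) has_sum (S - f 0) / 2) {1..}"
proof -
  let ?g = "\<lambda>n. f (int n)"
  have "f summable_on (int ` {1..})"
    by (rule summable_on_subset_banach[of f UNIV]) (use f has_sum_imp_summable in auto)
  hence "?g summable_on {1..}" by (subst (asm) summable_on_reindex) (auto simp: o_def)
  then obtain s where s: "(?g has_sum s) {1..}" by (auto simp: summable_on_def)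
  have 1: "(f has_sum s) (int ` {1..})"
    using s by (subst has_sum_reindex) (auto simp: o_def)
  have 2: "(f has_sum s) ((\<lambda>n. - int n) ` {1..})"
    using s by (subst has_sum_reindex) (auto simp: o_def sym inj_on_def)
  have "(f has_sum f 0) {0}" by (rule has_sum_finiteI) auto
  moreover have "int ` {1..} \<inter> (\<lambda>n. - int n) ` {1..} = {}" "{0} \<inter> (int ` {1..} \<union> (\<lambda>n. - int n) ` {1..}) = {}"
    by auto
  ultimately have "(f has_sum (f 0 + (s + s))) ({0} \<union> (int ` {1..} \<union> (\<lambda>n. - int n) ` {1..}))"
    by (intro has_sum_Un_disjoint 1 2)
  moreover have "{0} \<union> (int ` {1..} \<union> (\<lambda>n. - int n) ` {1..}) = (UNIV :: int set)"
  proof (rule UNIV_eq_I[symmetric])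
    fix x :: int
    show "x \<in> {0} \<union> (int ` {1..} \<union> (\<lambda>n. - int n) ` {1..})"
    proof (cases x)
      case (nonneg n)
      thus ?thesis by (cases "n = 0") auto
    next
      case (neg n)
      thus ?thesis by (intro UnI2 image_eqI[of _ _ "Suc n"]) auto
    qed
  qed
  ultimately have "S = f 0 + (s + s)" using f has_sum_unique by metis
  thus ?thesis using s by simp
qed

lemma has_sum_int_symmetric_odd:
  fixes f :: "int \<Rightarrow> complex"
  assumes f: "(f has_sum S) UNIV" and sym: "\<And>j. f (- j) = f j" and even: "\<And>j. even j \<Longrightarrow> f j = 0"
  shows "((\<lambda>r. f (2 * int r - 1)) has_sum S / 2) {1..}"
proof -
  have "((\<lambda>n. f (int n)) has_sum S / 2) {1..}"
    using has_sum_int_symmetric[OF f sym] even[of 0] by simp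
  hence "((\<lambda>n. f (int n)) has_sum S / 2) {n. odd n}"
    by (rule iffD1[OF has_sum_cong_neutral, rotated -1]) (auto simp: even elim: oddE)
  moreover have "bij_betw (\<lambda>r. 2 * r - 1) {1::nat..} {n. odd n}"
    by (rule bij_betwI[where g = "\<lambda>n. (n + 1) div 2"]) (auto elim!: oddE)
  ultimately have "((\<lambda>r. f (int (2 * r - 1))) has_sum S / 2) {1..}"
    using has_sum_reindex_bij_betw[of "\<lambda>r. 2 * r - 1" "{1::nat..}" "{n. odd n}" "\<lambda>n. f (int n)"] by blast
  thus ?thesis
    by (rule iffD1[OF has_sum_cong, rotated]) (simp add: of_nat_diff)
qed

lemma has_sum_int_symmetric_even:
  fixes f :: "int \<Rightarrow> complex"
  assumes f: "(f has_sum S) UNIV" and sym: "\<And>j. f (- j) = f j" and odd: "\<And>j. odd j \<Longrightarrow> f j = 0"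
  shows "((\<lambda>r. f (2 * int r)) has_sum (S - f 0) / 2) {1..}"
proof -
  have "((\<lambda>n. f (int n)) has_sum (S - f 0) / 2) {1..}"
    using has_sum_int_symmetric[OF f sym] by simp
  hence "((\<lambda>n. f (int n)) has_sum (S - f 0) / 2) {n. even n \<and> n \<ge> 1}"
    by (rule iffD1[OF has_sum_cong_neutral, rotated -1]) (auto simp: odd)
  moreover have "bij_betw (\<lambda>r. 2 * r) {1::nat..} {n. even n \<and> n \<ge> 1}"
    by (rule bij_betwI[where g = "\<lambda>n. n div 2"]) (auto elim!: evenE)
  ultimately have "((\<lambda>r. f (int (2 * r))) has_sum (S - f 0) / 2) {1..}"
    using has_sum_reindex_bij_betw[of "\<lambda>r. 2 * r" "{1::nat..}" "{n. even n \<and> n \<ge> 1}" "\<lambda>n. f (int n)"] by blast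
  thus ?thesis by simp
qed

lemma has_sum_eq_cmult_infsum_of_real:
  assumes "((\<lambda>x. w * complex_of_real (t x)) has_sum S) A" "w \<noteq> 0"
  shows "S = w * of_real (infsum t A)"
proof -
  have "((\<lambda>x. 1 / w * (w * complex_of_real (t x))) has_sum 1 / w * S) A"
    by (rule has_sum_cmult_right[OF assms(1)])
  hence *: "((\<lambda>x. complex_of_real (t x)) has_sum S / w) A"
    using assms(2) by simp
  have "(t has_sum Re (S / w)) A" using has_sum_Re[OF *] by simp
  hence "(t has_sum infsum t A) A" using has_sum_infsum has_sum_imp_summable by blast
  hence "((\<lambda>x. complex_of_real (t x)) has_sum of_real (infsum t A)) A" by (rule has_sum_of_real)
  from has_sum_unique[OF * this] show ?thesis using assms(2) by (simp add: field_simps)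
qed

text \<open>The n-th derivative of \<open>expsum a\<close>, taken termwise. For \<open>n = 0\<close>
  the convention \<open>0 ^ 0 = 1\<close> keeps the constant term.\<close>

definition deriv_sum :: "(int \<Rightarrow> complex) \<Rightarrow> nat \<Rightarrow> complex \<Rightarrow> complex" where
  "deriv_sum a n = expsum (\<lambda>j. of_int j ^ n * a j)"

lemma deriv_sum_0 [simp]: "deriv_sum a 0 = expsum a"
  by (simp add: deriv_sum_def)

lemma strip_coeffs_index_power: "strip_coeffs h a \<Longrightarrow> strip_coeffs h (\<lambda>j. of_int j ^ n * a j)"
  by (induction n) (auto simp: mult.assoc dest: strip_coeffs_times_index)

lemma deriv_sum_has_derivative:
  assumes "strip_coeffs h a" "\<bar>Re z\<bar> < h"
  shows "(deriv_sum a n has_field_derivative deriv_sum a (Suc n) z) (at z)"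
  using expsum_has_field_derivative[OF strip_coeffs_index_power[OF assms(1)] assms(2), of n]
  by (simp add: deriv_sum_def mult.assoc)

lemma deriv_sum_has_sum:
  assumes "strip_coeffs h a" "\<bar>Re z\<bar> < h"
  shows "((\<lambda>j. of_int j ^ n * a j * exp (of_int j * z)) has_sum deriv_sum a n z) UNIV"
  unfolding deriv_sum_def by (rule expsum_has_sum[OF strip_coeffs_index_power[OF assms(1)] assms(2)])

context nome_parameter
begin

lemma deriv_sum_cubic_ode:
  assumes a: "strip_coeffs h a"
    and y1: "\<And>z. \<bar>Re z\<bar> < h \<Longrightarrow> (expsum a has_field_derivative y1 z) (at z)"
    and y2: "\<And>z. \<bar>Re z\<bar> < h \<Longrightarrow> (y1 has_field_derivative 2 * expsum a z ^ 3 + c * expsum a z) (at z)"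
    and x: "\<bar>Re x\<bar> < h" "y1 x = 0"
  shows "deriv_sum a 2 x = 2 * expsum a x ^ 3 + c * expsum a x"
    and "deriv_sum a 4 x = (6 * expsum a x ^ 2 + c) * deriv_sum a 2 x"
proof -
  note der = deriv_sum_has_derivative[OF a]
  have 1: "deriv_sum a 1 z = y1 z" if "\<bar>Re z\<bar> < h" for z
    using DERIV_unique[OF der[OF that, of 0]] y1[OF that] by simp
  have 2: "deriv_sum a 2 z = 2 * expsum a z ^ 3 + c * expsum a z" if "\<bar>Re z\<bar> < h" for z
  proof -
    have "(deriv_sum a 1 has_field_derivative deriv_sum a 2 z) (at z)"
      using der[OF that, of 1] by (simp add: numeral_2_eq_2)
    from has_field_derivative_unique_on_open[OF open_strip _ _ this y2[OF that]] show ?thesis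
      using that 1 by simp
  qed
  show "deriv_sum a 2 x = 2 * expsum a x ^ 3 + c * expsum a x" by (rule 2[OF x(1)])
  show "deriv_sum a 4 x = (6 * expsum a x ^ 2 + c) * deriv_sum a 2 x"
  proof (rule fourth_derivative_cubic_ode[OF open_strip, where y = "expsum a" and ?y1.0 = "deriv_sum a 1"
        and ?y2.0 = "deriv_sum a 2" and ?y3.0 = "deriv_sum a 3"])
    show "deriv_sum a 1 x = 0" using 1 x by simp
    show "(deriv_sum a 3 has_field_derivative deriv_sum a 4 x) (at x)"
      using der[OF x(1), of 3] by simp
  qed (use x 2 der[of _ 0] der[of _ 1] der[of _ 2] in \<open>auto simp: numeral_2_eq_2 numeral_3_eq_3\<close>)
qed

section \<open>Even derivatives of cn, dn and sn at critical points\<close>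

lemma strip_0: "\<bar>Re 0\<bar> < h" using h_pos by simp

lemma strip_half_pi: "\<bar>Re (\<i> * of_real (pi / 2))\<bar> < h" using h_pos by simp

lemma sn_sq: "\<bar>Re z\<bar> < h \<Longrightarrow> sn z ^ 2 = cn z ^ 2 - of_real c0 ^ 2"
  using cn_sn_sq[of z] by (simp add: cn_0 algebra_simps)

lemma dn_sq: "\<bar>Re z\<bar> < h \<Longrightarrow> dn z ^ 2 = sn z ^ 2 + of_real d0 ^ 2"
  using dn_sn_sq[of z] by (simp add: dn_0 algebra_simps)

lemma cn_derivs:
  "deriv_sum cn_coeff 2 0 = of_real (c0 * d0 ^ 2)"
  "deriv_sum cn_coeff 4 0 = of_real ((4 * c0 ^ 2 + d0 ^ 2) * (c0 * d0 ^ 2))"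
proof -
  have y2: "((\<lambda>z. sn z * dn z) has_field_derivative 2 * cn z ^ 3 + of_real (d0 ^ 2 - 2 * c0 ^ 2) * cn z) (at z)" 
    if z: "\<bar>Re z\<bar> < h" for z
  proof -
    have "((\<lambda>z. sn z * dn z) has_field_derivative cn z * (dn z ^ 2 + sn z ^ 2)) (at z)"
      by (rule derivative_eq_intros sn_has_derivative[OF z] dn_has_derivative[OF z] refl)+
         (simp add: power2_eq_square algebra_simps)
    also have "cn z * (dn z ^ 2 + sn z ^ 2) = 2 * cn z ^ 3 + of_real (d0 ^ 2 - 2 * c0 ^ 2) * cn z"
      unfolding dn_sq[OF z] sn_sq[OF z] by (simp add: algebra_simps power2_eq_square power3_eq_cube)
    finally show ?thesis .
  qed
  note * = deriv_sum_cubic_ode[OF strip_coeffs_cn cn_has_derivative[unfolded cn_def] y2[unfolded cn_def] strip_0,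
    folded cn_def, simplified cn_0]
  show 2: "deriv_sum cn_coeff 2 0 = of_real (c0 * d0 ^ 2)"
    using *(1) by (simp add: algebra_simps power2_eq_square power3_eq_cube)
  show "deriv_sum cn_coeff 4 0 = of_real ((4 * c0 ^ 2 + d0 ^ 2) * (c0 * d0 ^ 2))"
    using *(2) unfolding 2 by (simp add: algebra_simps)
qed

lemma dn_derivs:
  "deriv_sum dn_coeff 2 0 = of_real (c0 ^ 2 * d0)"
  "deriv_sum dn_coeff 4 0 = of_real ((4 * d0 ^ 2 + c0 ^ 2) * (c0 ^ 2 * d0))"
proof -
  have y2: "((\<lambda>z. sn z * cn z) has_field_derivative 2 * dn z ^ 3 + of_real (c0 ^ 2 - 2 * d0 ^ 2) * dn z) (at z)" 
    if z: "\<bar>Re z\<bar> < h" for z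
  proof -
    have "((\<lambda>z. sn z * cn z) has_field_derivative dn z * (cn z ^ 2 + sn z ^ 2)) (at z)"
      by (rule derivative_eq_intros sn_has_derivative[OF z] cn_has_derivative[OF z] refl)+
         (simp add: power2_eq_square algebra_simps)
    also have "cn z ^ 2 = sn z ^ 2 + of_real c0 ^ 2" using sn_sq[OF z] by simp
    also have "sn z ^ 2 = dn z ^ 2 - of_real d0 ^ 2" using dn_sq[OF z] by simp
    also have "dn z * (dn z ^ 2 - of_real d0 ^ 2 + of_real c0 ^ 2 + (dn z ^ 2 - of_real d0 ^ 2))
        = 2 * dn z ^ 3 + of_real (c0 ^ 2 - 2 * d0 ^ 2) * dn z"
      by (simp add: algebra_simps power2_eq_square power3_eq_cube)
    finally show ?thesis .
  qed
  note * = deriv_sum_cubic_ode[OF strip_coeffs_dn dn_has_derivative[unfolded dn_def] y2[unfolded dn_def] strip_0,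
    folded dn_def, simplified dn_0]
  show 2: "deriv_sum dn_coeff 2 0 = of_real (c0 ^ 2 * d0)"
    using *(1) by (simp add: algebra_simps power2_eq_square power3_eq_cube)
  show "deriv_sum dn_coeff 4 0 = of_real ((4 * d0 ^ 2 + c0 ^ 2) * (c0 ^ 2 * d0))"
    using *(2) unfolding 2 by (simp add: algebra_simps)
qed

lemma cn_half_pi: "cn (\<i> * of_real (pi / 2)) = 0"
  and sn_half_pi: "sn (\<i> * of_real (pi / 2)) = \<i> * of_real c0"
  using cn_eq_cosh_am[OF strip_half_pi] sn_eq_sinh_am[OF strip_half_pi]
  unfolding am_half_pi by (simp_all add: cosh_conv_cos sinh_conv_sin cn_0 cos_of_real sin_of_real
      flip: of_real_divide del: of_real_divide)

text \<open>As \<open>sn\<close> is odd, its even derivatives at 0 vanish. The zero of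
  \<open>cn\<close> at \<open>i pi / 2\<close> provides the critical point instead.\<close>

lemma sn_derivs:
  "deriv_sum sn_coeff 2 (\<i> * of_real (pi / 2)) = \<i> * of_real (c0 * (d0 ^ 2 - c0 ^ 2))"
  "deriv_sum sn_coeff 4 (\<i> * of_real (pi / 2)) = \<i> * of_real (c0 * (d0 ^ 2 - c0 ^ 2) * (d0 ^ 2 - 5 * c0 ^ 2))"
proof -
  have y2: "((\<lambda>z. cn z * dn z) has_field_derivative 2 * sn z ^ 3 + of_real (c0 ^ 2 + d0 ^ 2) * sn z) (at z)" 
    if z: "\<bar>Re z\<bar> < h" for z
  proof -
    have "((\<lambda>z. cn z * dn z) has_field_derivative sn z * (cn z ^ 2 + dn z ^ 2)) (at z)"
      by (rule derivative_eq_intros dn_has_derivative[OF z] cn_has_derivative[OF z] refl)+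
         (simp add: power2_eq_square algebra_simps)
    also have "cn z ^ 2 = sn z ^ 2 + of_real c0 ^ 2" using sn_sq[OF z] by simp
    also have "dn z ^ 2 = sn z ^ 2 + of_real d0 ^ 2" by (rule dn_sq[OF z])
    also have "sn z * (sn z ^ 2 + of_real c0 ^ 2 + (sn z ^ 2 + of_real d0 ^ 2))
        = 2 * sn z ^ 3 + of_real (c0 ^ 2 + d0 ^ 2) * sn z"
      by (simp add: algebra_simps power2_eq_square power3_eq_cube)
    finally show ?thesis .
  qed
  have crit: "cn (\<i> * of_real (pi / 2)) * dn (\<i> * of_real (pi / 2)) = 0" by (simp only: cn_half_pi mult_zero_left)
  note * = deriv_sum_cubic_ode[OF strip_coeffs_sn sn_has_derivative[unfolded sn_def] y2[unfolded sn_def] strip_half_pi crit,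
    folded sn_def, unfolded sn_half_pi]
  show 2: "deriv_sum sn_coeff 2 (\<i> * of_real (pi / 2)) = \<i> * of_real (c0 * (d0 ^ 2 - c0 ^ 2))"
    using *(1) by (simp add: complex_eq_iff algebra_simps power2_eq_square power3_eq_cube)
  show "deriv_sum sn_coeff 4 (\<i> * of_real (pi / 2)) = \<i> * of_real (c0 * (d0 ^ 2 - c0 ^ 2) * (d0 ^ 2 - 5 * c0 ^ 2))"
    using *(2)[unfolded 2] by (simp add: complex_eq_iff algebra_simps power2_eq_square power3_eq_cube)
qed

end

section \<open>Even derivatives of the regularised reciprocal of sn\<close>

lemma csch_derivs:
  fixes z :: complex
  assumes "sinh z \<noteq> 0"
  shows "((\<lambda>z. - (1 / sinh z)) has_field_derivative cosh z / sinh z ^ 2) (at z)"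
    and "((\<lambda>z. cosh z / sinh z ^ 2) has_field_derivative - (2 / sinh z ^ 3) - 1 / sinh z) (at z)"
    and "((\<lambda>z. - (2 / sinh z ^ 3) - 1 / sinh z) has_field_derivative 6 * cosh z / sinh z ^ 4 + cosh z / sinh z ^ 2) (at z)"
proof -
  show "((\<lambda>z. - (1 / sinh z)) has_field_derivative cosh z / sinh z ^ 2) (at z)"
    by (rule derivative_eq_intros refl assms)+ (simp add: power2_eq_square)
  have alg: "(S * S ^ 2 - C * (2 * S * C)) / (S ^ 2 * S ^ 2) = - (2 / S ^ 3) - 1 / S"
    if "S \<noteq> 0" "C ^ 2 = S ^ 2 + 1" for S C :: complex
  proof -
    have "S * S ^ 2 - C * (2 * S * C) = S * S ^ 2 - 2 * S * C ^ 2" by (simp add: power2_eq_square)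
    also have "\<dots> = - (S ^ 3) - 2 * S" unfolding that(2) by (simp add: algebra_simps power2_eq_square power3_eq_cube)
    finally have "(S * S ^ 2 - C * (2 * S * C)) / (S ^ 2 * S ^ 2) = (- (S ^ 3) - 2 * S) / (S ^ 2 * S ^ 2)"
      by (rule arg_cong)
    also have "\<dots> = - (2 / S ^ 3) - 1 / S"
      using that(1) by (simp add: field_simps eval_nat_numeral)
    finally show ?thesis .
  qed
  show "((\<lambda>z. cosh z / sinh z ^ 2) has_field_derivative - (2 / sinh z ^ 3) - 1 / sinh z) (at z)"
    unfolding alg[OF assms cosh_square_eq, symmetric]
    by (rule derivative_eq_intros refl)+ (use assms in \<open>simp_all add: algebra_simps\<close>)
  have nz: "sinh z ^ 3 \<noteq> 0" using assms by simp
  show "((\<lambda>z. - (2 / sinh z ^ 3) - 1 / sinh z) has_field_derivative 6 * cosh z / sinh z ^ 4 + cosh z / sinh z ^ 2) (at z)"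
    by (rule derivative_eq_intros refl assms nz)+ (use assms in \<open>simp_all add: field_simps eval_nat_numeral\<close>)
qed

text \<open>Since \<open>- csch (i pi / 2 + w) = i * sech w\<close>, the even derivatives of
  \<open>- csch\<close> at \<open>i pi / 2\<close> are \<open>i\<close> times the Euler numbers 1,
  -1, 5. These are the constants beside the R series, up to sign.\<close>

lemma csch_fourth_deriv:
  assumes "sinh z = \<i>" "cosh z = 0"
  shows "((\<lambda>z. 6 * cosh z / sinh z ^ 4 + cosh z / sinh z ^ 2) has_field_derivative 5 * \<i>) (at z)"
proof -
  have nz: "sinh z ^ 4 \<noteq> 0" "sinh z ^ 2 \<noteq> 0" using assms by auto
  show ?thesis
    by (rule derivative_eq_intros refl nz)+ (simp add: assms eval_nat_numeral)
qed

lemma sech_eq: "1 / cosh x = 2 * (exp (- x) / (1 + exp (- x) ^ 2))" for x :: real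
  by (simp add: cosh_def exp_minus field_simps power2_eq_square add_eq_0_iff)

lemma csch_eq: "x > 0 \<Longrightarrow> 1 / sinh x = 2 * (exp (- x) / (1 - exp (- x) ^ 2))" for x :: real
proof -
  assume "x > 0"
  hence "exp (- x) ^ 2 < 1" by (simp add: power_less_one_iff)
  moreover have "sinh x = (1 - exp (- x) ^ 2) / (2 * exp (- x))"
    by (simp add: sinh_def exp_minus field_simps power2_eq_square)
  ultimately show ?thesis by simp
qed

lemma coth_minus_one_eq: "x > 0 \<Longrightarrow> 1 / tanh x - 1 = 2 * (exp (- x) ^ 2 / (1 - exp (- x) ^ 2))" for x :: real
proof -
  assume x: "x > 0"
  have "1 / tanh x - 1 = (cosh x - sinh x) * (1 / sinh x)"
    using x by (simp add: tanh_def field_simps)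
  also have "\<dots> = 2 * (exp (- x) ^ 2 / (1 - exp (- x) ^ 2))"
    unfolding cosh_minus_sinh csch_eq[OF x] by (simp add: power2_eq_square)
  finally show ?thesis .
qed

context nome_parameter
begin

lemma sinh_half_pi: "sinh (\<i> * of_real (pi / 2)) = \<i>" and cosh_half_pi: "cosh (\<i> * of_real (pi / 2)) = 0"
  by (simp_all add: cosh_conv_cos sinh_conv_sin cos_of_real sin_of_real flip: of_real_divide del: of_real_divide)

text \<open>The function \<open>csch - en\<close> is \<open>c0 * d0 / sn\<close>, so it satisfies the same equation as \<open>sn\<close>.\<close>
lemma en_derivs:
  "deriv_sum en_coeff 0 (\<i> * of_real (pi / 2)) = \<i> * of_real (d0 - 1)"
  "deriv_sum en_coeff 2 (\<i> * of_real (pi / 2)) = \<i> * of_real (1 - d0 * (d0 ^ 2 - c0 ^ 2))"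
  "deriv_sum en_coeff 4 (\<i> * of_real (pi / 2)) = \<i> * of_real (d0 * (5 * d0 ^ 2 - c0 ^ 2) * (d0 ^ 2 - c0 ^ 2) - 5)"
proof -
  let ?x = "\<i> * complex_of_real (pi / 2)"
  define K where "K = complex_of_real c0 * of_real d0"
  \<comment> \<open>The equations for 1/sn and the cosecant are differentiated on an open set around
    \<open>i pi / 2\<close> that avoids the zeros of both denominators.\<close>
  define U where "U = {z. \<bar>Re z\<bar> < h} \<inter> (\<lambda>z. sn z * sinh z) -` (- {0})"
  define y where "y z = deriv_sum en_coeff 0 z + - (1 / sinh z)" for z
  define y1 where "y1 z = deriv_sum en_coeff 1 z + cosh z / sinh z ^ 2" for z
  define y2 where "y2 z = deriv_sum en_coeff 2 z + (- (2 / sinh z ^ 3) - 1 / sinh z)" for z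
  define y3 where "y3 z = deriv_sum en_coeff 3 z + (6 * cosh z / sinh z ^ 4 + cosh z / sinh z ^ 2)" for z
  note der = deriv_sum_has_derivative[OF strip_coeffs_en]
  have U: "\<bar>Re z\<bar> < h" "sn z \<noteq> 0" "sinh z \<noteq> 0" if "z \<in> U" for z using that by (auto simp: U_def)
  have x: "?x \<in> U"
    using strip_half_pi sn_half_pi sinh_half_pi c0_pos by (simp add: U_def)
  have "continuous_on {z. \<bar>Re z\<bar> < h} (\<lambda>z. sn z * sinh z)"
    by (intro continuous_intros DERIV_continuous_on[OF has_field_derivative_at_within[OF sn_has_derivative]]) auto
  hence "open U" unfolding U_def by (intro continuous_open_preimage open_strip) auto
  have y: "(y has_field_derivative y1 z) (at z)" "(y1 has_field_derivative y2 z) (at z)"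
    "(y2 has_field_derivative y3 z) (at z)" if z: "z \<in> U" for z
  proof -
    have d: "(deriv_sum en_coeff 0 has_field_derivative deriv_sum en_coeff 1 z) (at z)"
      "(deriv_sum en_coeff 1 has_field_derivative deriv_sum en_coeff 2 z) (at z)"
      "(deriv_sum en_coeff 2 has_field_derivative deriv_sum en_coeff 3 z) (at z)"
      using der[OF U(1)[OF z], of 0] der[OF U(1)[OF z], of 1] der[OF U(1)[OF z], of 2]
      by (simp_all add: numeral_2_eq_2 numeral_3_eq_3)
    show "(y has_field_derivative y1 z) (at z)" "(y1 has_field_derivative y2 z) (at z)"
      "(y2 has_field_derivative y3 z) (at z)"
      unfolding y_def[abs_def] y1_def[abs_def] y2_def[abs_def] y3_def
      by (rule DERIV_add d csch_derivs U(3)[OF z])+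
  qed
  have y4: "(y3 has_field_derivative deriv_sum en_coeff 4 ?x + 5 * \<i>) (at ?x)"
    unfolding y3_def[abs_def]
    using DERIV_add[OF der[OF U(1)[OF x], of 3] csch_fourth_deriv[OF sinh_half_pi cosh_half_pi]] by simp
  have y_eq: "y z = - K / sn z" if "z \<in> U" for z
  proof -
    have "y z = - (1 - sinh z * en z) / sinh z"
      using U(3)[OF that] by (simp add: y_def en_def field_simps)
    also have "\<dots> = - (sn z * (1 - sinh z * en z)) / (sinh z * sn z)"
      using U(2,3)[OF that] by (simp add: field_simps)
    also have "\<dots> = - K / sn z"
      unfolding sn_en[OF U(1)[OF that]] using U[OF that] by (simp add: K_def cn_0 dn_0)
    finally show ?thesis .
  qed
  have y1_eq: "y1 z = K * cn z * dn z / sn z ^ 2" if z: "z \<in> U" for z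
  proof (rule has_field_derivative_unique_on_open[OF \<open>open U\<close> z y_eq y(1)[OF z]])
    show "((\<lambda>z. - K / sn z) has_field_derivative K * cn z * dn z / sn z ^ 2) (at z)"
      by (rule derivative_eq_intros sn_has_derivative[OF U(1)[OF z]] refl U(2)[OF z])+ (simp add: power2_eq_square)
  qed
  \<comment> \<open>\<open>S\<close>, \<open>C\<close>, \<open>D\<close> stand for
    \<open>sn\<close>, \<open>cn\<close>, \<open>dn\<close>. Eliminating \<open>C^2\<close> and
    \<open>D^2\<close> turns the output of the quotient rule into a cubic polynomial in
    \<open>- K / S\<close>.\<close>
  have alg: "(K * (S * D * D + C * (S * C)) * S ^ 2 - K * C * D * (2 * S * (C * D))) / (S ^ 2 * S ^ 2) =
      2 * (- K / S) ^ 3 + (of_real c0 ^ 2 + of_real d0 ^ 2) * (- K / S)"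
    if "S \<noteq> 0" "C ^ 2 = S ^ 2 + of_real c0 ^ 2" "D ^ 2 = S ^ 2 + of_real d0 ^ 2" for S C D
  proof -
    have "K * (S * D * D + C * (S * C)) * S ^ 2 - K * C * D * (2 * S * (C * D)) = K * S * ((D ^ 2 + C ^ 2) * S ^ 2 - 2 * C ^ 2 * D ^ 2)"
      by (simp add: algebra_simps power2_eq_square)
    also have "\<dots> = K * S * (- (of_real c0 ^ 2 + of_real d0 ^ 2) * S ^ 2 - 2 * K ^ 2)"
      unfolding that(2,3) K_def by (simp add: algebra_simps power2_eq_square)
    finally have "(K * (S * D * D + C * (S * C)) * S ^ 2 - K * C * D * (2 * S * (C * D))) / (S ^ 2 * S ^ 2) =
        K * S * (- (of_real c0 ^ 2 + of_real d0 ^ 2) * S ^ 2 - 2 * K ^ 2) / (S ^ 2 * S ^ 2)"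
      by (rule arg_cong)
    also have "\<dots> = 2 * (- K / S) ^ 3 + (of_real c0 ^ 2 + of_real d0 ^ 2) * (- K / S)"
      using that(1) by (simp add: field_simps eval_nat_numeral)
    finally show ?thesis .
  qed
  have ode: "y2 z = 2 * y z ^ 3 + (of_real c0 ^ 2 + of_real d0 ^ 2) * y z" if z: "z \<in> U" for z
    unfolding y_eq[OF z]
  proof (rule has_field_derivative_unique_on_open[OF \<open>open U\<close> z y1_eq y(2)[OF z]])
    have sq: "cn z ^ 2 = sn z ^ 2 + of_real c0 ^ 2" "dn z ^ 2 = sn z ^ 2 + of_real d0 ^ 2"
      using sn_sq[OF U(1)[OF z]] dn_sq[OF U(1)[OF z]] by simp_all
    show "((\<lambda>z. K * cn z * dn z / sn z ^ 2) has_field_derivative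
        2 * (- K / sn z) ^ 3 + (of_real c0 ^ 2 + of_real d0 ^ 2) * (- K / sn z)) (at z)"
      unfolding alg[OF U(2)[OF z] sq, symmetric]
      by (rule derivative_eq_intros cn_has_derivative[OF U(1)[OF z]] dn_has_derivative[OF U(1)[OF z]]
            sn_has_derivative[OF U(1)[OF z]] refl)+
         (use U(2)[OF z] in \<open>simp_all add: algebra_simps\<close>)
  qed
  have crit: "y1 ?x = 0" unfolding y1_eq[OF x] cn_half_pi by simp
  have y4_eq: "deriv_sum en_coeff 4 ?x + 5 * \<i> = (6 * y ?x ^ 2 + (of_real c0 ^ 2 + of_real d0 ^ 2)) * y2 ?x"
    by (rule fourth_derivative_cubic_ode[OF \<open>open U\<close> x y y4 ode crit])
  have y_x: "y ?x = \<i> * of_real d0"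
    unfolding y_eq[OF x] sn_half_pi using c0_pos by (simp add: K_def complex_eq_iff field_simps)
  have y2_x: "y2 ?x = \<i> * of_real (- d0 * (d0 ^ 2 - c0 ^ 2))"
    unfolding ode[OF x] y_x by (simp add: complex_eq_iff algebra_simps power2_eq_square power3_eq_cube)
  show "deriv_sum en_coeff 0 ?x = \<i> * of_real (d0 - 1)"
    using y_x unfolding y_def sinh_half_pi by (simp add: algebra_simps)
  show "deriv_sum en_coeff 2 ?x = \<i> * of_real (1 - d0 * (d0 ^ 2 - c0 ^ 2))"
    using y2_x unfolding y2_def sinh_half_pi by (simp add: power3_eq_cube algebra_simps)
  have "deriv_sum en_coeff 4 ?x = (6 * (\<i> * of_real d0) ^ 2 + (of_real c0 ^ 2 + of_real d0 ^ 2)) * (\<i> * of_real (- d0 * (d0 ^ 2 - c0 ^ 2))) - 5 * \<i>"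
    using y4_eq unfolding y_x y2_x by (simp add: algebra_simps)
  also have "\<dots> = \<i> * of_real (d0 * (5 * d0 ^ 2 - c0 ^ 2) * (d0 ^ 2 - c0 ^ 2) - 5)"
    by (simp add: complex_eq_iff algebra_simps power2_eq_square power3_eq_cube)
  finally show "deriv_sum en_coeff 4 ?x = \<i> * of_real (d0 * (5 * d0 ^ 2 - c0 ^ 2) * (d0 ^ 2 - c0 ^ 2) - 5)" .
qed

section \<open>Lambert series as derivatives of the Fourier series\<close>

lemma nome_powr: "exp (- 2 * h) powr (real r - 1 / 2) = exp (- ((2 * real r - 1) * h))"
  by (simp add: powr_def algebra_simps)

lemma nome_odd_power: "r \<ge> 1 \<Longrightarrow> exp (- 2 * h) ^ (2 * r - 1) = exp (- ((2 * real r - 1) * h)) ^ 2"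
  by (simp add: exp_of_nat_mult[symmetric] of_nat_diff algebra_simps flip: exp_double)

text \<open>One factor 2 comes from \<open>sech x = 2 exp (- x) / (1 + exp (- 2 x))\<close>, the
  other from pairing \<open>j\<close> with \<open>- j\<close>.\<close>

lemma deriv_sum_cn: "deriv_sum cn_coeff (2 * m) 0 = of_real (4 * serT m (exp (- 2 * h)))"
proof -
  let ?t = "\<lambda>r. (2 * real r - 1) ^ (2 * m) * exp (- 2 * h) powr (real r - 1 / 2) / (1 + exp (- 2 * h) ^ (2 * r - 1))"
  have "((\<lambda>r. of_int (2 * int r - 1) ^ (2 * m) * cn_coeff (2 * int r - 1) * exp (of_int (2 * int r - 1) * 0)) 
      has_sum deriv_sum cn_coeff (2 * m) 0 / 2) {1..}"
    by (rule has_sum_int_symmetric_odd[OF deriv_sum_has_sum[OF strip_coeffs_cn strip_0]]) (auto simp: cn_coeff_def)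
  hence "((\<lambda>r. 2 * complex_of_real (?t r)) has_sum deriv_sum cn_coeff (2 * m) 0 / 2) {1..}"
  proof (rule iffD1[OF has_sum_cong, rotated])
    fix r :: nat assume "r \<in> {1..}"
    hence r: "r \<ge> 1" by simp
    have "(2 * real r - 1) ^ (2 * m) * (1 / cosh ((2 * real r - 1) * h)) = 2 * ?t r"
      unfolding sech_eq nome_powr nome_odd_power[OF r] by simp
    from arg_cong[OF this, of complex_of_real]
    show "of_int (2 * int r - 1) ^ (2 * m) * cn_coeff (2 * int r - 1) * exp (of_int (2 * int r - 1) * 0) = 2 * complex_of_real (?t r)"
      by (simp add: cn_coeff_def)
  qed
  from has_sum_eq_cmult_infsum_of_real[OF this] show ?thesis
    by (simp add: serT_def)
qed

text \<open>The indices are \<open>2 r\<close>, so \<open>(2 r) ^ (2 m)\<close> contributes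
  \<open>4 ^ m\<close> besides the factor 4. The unpaired term \<open>j = 0\<close> contributes 1,
  and only for \<open>m = 0\<close>.\<close>

lemma deriv_sum_dn: "deriv_sum dn_coeff (2 * m) 0 = of_real ((if m = 0 then 1 else 0) + 4 ^ (m + 1) * serN m (exp (- 2 * h)))"
proof -
  let ?t = "\<lambda>r. real r ^ (2 * m) * exp (- 2 * h) ^ r / (1 + exp (- 2 * h) ^ (2 * r))"
  have "((\<lambda>r. of_int (2 * int r) ^ (2 * m) * dn_coeff (2 * int r) * exp (of_int (2 * int r) * 0)) 
      has_sum (deriv_sum dn_coeff (2 * m) 0 - of_int 0 ^ (2 * m) * dn_coeff 0 * exp (of_int 0 * 0)) / 2) {1..}"
    by (rule has_sum_int_symmetric_even[OF deriv_sum_has_sum[OF strip_coeffs_dn strip_0]]) (auto simp: dn_coeff_def)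
  hence "((\<lambda>r. (2 * 4 ^ m) * complex_of_real (?t r)) has_sum
      (deriv_sum dn_coeff (2 * m) 0 - of_int 0 ^ (2 * m) * dn_coeff 0 * exp (of_int 0 * 0)) / 2) {1..}"
  proof (rule iffD1[OF has_sum_cong, rotated])
    fix r :: nat
    have e: "exp (- 2 * h) ^ r = exp (- (2 * real r * h))" by (simp add: exp_of_nat_mult[symmetric])
    have "(2 * real r) ^ (2 * m) * (1 / cosh (2 * real r * h)) = 2 * 4 ^ m * ?t r"
      unfolding sech_eq power_mult[of _ 2 r, symmetric] mult.commute[of 2 r] power_mult e
      by (simp add: power_mult_distrib power_mult)
    from arg_cong[OF this, of complex_of_real]
    show "of_int (2 * int r) ^ (2 * m) * dn_coeff (2 * int r) * exp (of_int (2 * int r) * 0) = (2 * 4 ^ m) * complex_of_real (?t r)"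
      by (simp add: dn_coeff_def)
  qed
  from has_sum_eq_cmult_infsum_of_real[OF this]
  have "deriv_sum dn_coeff (2 * m) 0 - of_int 0 ^ (2 * m) * dn_coeff 0 = of_real (4 ^ (m + 1) * serN m (exp (- 2 * h)))"
    by (simp add: serN_def field_simps)
  thus ?thesis by (cases m) (auto simp: dn_coeff_def algebra_simps)
qed

text \<open>The source of the alternating signs in \<open>serThat\<close> and
  \<open>serR\<close>.\<close>

lemma exp_odd_half_pi:
  "r \<ge> 1 \<Longrightarrow> exp (of_int (2 * int r - 1) * (\<i> * of_real (pi / 2))) = - \<i> * (- 1) ^ r"
proof -
  assume "r \<ge> 1"
  have "of_int (2 * int r - 1) * (\<i> * of_real (pi / 2)) = of_nat r * (\<i> * of_real pi) + - (\<i> * of_real (pi / 2))"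
    by (simp add: field_simps)
  also have "exp \<dots> = exp (\<i> * of_real pi) ^ r * exp (- (\<i> * of_real (pi / 2)))"
    by (simp only: exp_add exp_of_nat_mult)
  also have "exp (- (\<i> * of_real (pi / 2))) = - \<i>"
    by (simp add: complex_eq_iff Re_exp Im_exp)
  finally show ?thesis by simp
qed

text \<open>The coefficients of \<open>sn\<close> and \<open>en\<close> are odd in \<open>j\<close>;
  this second sign makes the summands even, so that \<open>j\<close> and \<open>- j\<close> can be
  paired.\<close>

lemma exp_half_pi_reflect:
  assumes "odd j"
  shows "exp (of_int (- j) * (\<i> * of_real (pi / 2))) = - exp (of_int j * (\<i> * of_real (pi / 2)))"
proof -
  have "exp (of_int j * (\<i> * of_real pi)) = exp (\<i> * of_real pi) powi j"
    by (simp only: exp_power_int)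
  also have "\<dots> = - 1" using assms by auto
  finally have "exp (of_int (- j) * (\<i> * of_real (pi / 2))) * - 1
      = exp (of_int (- j) * (\<i> * of_real (pi / 2))) * exp (of_int j * (\<i> * of_real pi))" by simp
  also have "\<dots> = exp (of_int j * (\<i> * of_real (pi / 2)))"
    unfolding exp_add[symmetric] by (rule arg_cong[of _ _ exp]) (simp add: algebra_simps)
  finally have "- exp (of_int (- j) * (\<i> * of_real (pi / 2))) = exp (of_int j * (\<i> * of_real (pi / 2)))"
    by (simp only: mult_minus_right mult_1_right)
  from arg_cong[OF this, of uminus] show ?thesis by (simp only: minus_minus)
qed

lemma deriv_sum_sn: "deriv_sum sn_coeff (2 * m) (\<i> * of_real (pi / 2)) = - \<i> * of_real (4 * serThat m (exp (- 2 * h)))"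
proof -
  let ?x = "\<i> * complex_of_real (pi / 2)"
  let ?t = "\<lambda>r. (2 * real r - 1) ^ (2 * m) * (- 1) ^ r * exp (- 2 * h) powr (real r - 1 / 2) / (1 - exp (- 2 * h) ^ (2 * r - 1))"
  have "((\<lambda>r. of_int (2 * int r - 1) ^ (2 * m) * sn_coeff (2 * int r - 1) * exp (of_int (2 * int r - 1) * ?x)) 
      has_sum deriv_sum sn_coeff (2 * m) ?x / 2) {1..}"
  proof (rule has_sum_int_symmetric_odd[OF deriv_sum_has_sum[OF strip_coeffs_sn strip_half_pi]])
    show "of_int (- j) ^ (2 * m) * sn_coeff (- j) * exp (of_int (- j) * ?x) = of_int j ^ (2 * m) * sn_coeff j * exp (of_int j * ?x)" for j
      using exp_half_pi_reflect[of j] by (cases "odd j") (simp_all add: sn_coeff_def)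
  qed (auto simp: sn_coeff_def)
  hence "((\<lambda>r. (- 2 * \<i>) * complex_of_real (?t r)) has_sum deriv_sum sn_coeff (2 * m) ?x / 2) {1..}"
  proof (rule iffD1[OF has_sum_cong, rotated])
    fix r :: nat assume "r \<in> {1..}"
    hence r: "r \<ge> 1" by simp
    hence "(2 * real r - 1) * h > 0" using h_pos by simp
    hence "(2 * real r - 1) ^ (2 * m) * (1 / sinh ((2 * real r - 1) * h)) * (- 1) ^ r = 2 * ?t r"
      unfolding nome_powr nome_odd_power[OF r] by (subst csch_eq) simp_all
    from arg_cong[OF this, of "\<lambda>x. - \<i> * complex_of_real x"]
    show "of_int (2 * int r - 1) ^ (2 * m) * sn_coeff (2 * int r - 1) * exp (of_int (2 * int r - 1) * ?x) = (- 2 * \<i>) * complex_of_real (?t r)"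
      unfolding exp_odd_half_pi[OF r] by (simp add: sn_coeff_def mult_ac)
  qed
  from has_sum_eq_cmult_infsum_of_real[OF this] show ?thesis
    by (simp add: serThat_def)
qed

lemma deriv_sum_en: "deriv_sum en_coeff (2 * m) (\<i> * of_real (pi / 2)) = - \<i> * of_real (4 * serR m (- exp (- 2 * h)))"
proof -
  let ?x = "\<i> * complex_of_real (pi / 2)"
  let ?t = "\<lambda>r. (- 1) ^ (r + 1) * ((2 * real r - 1) ^ (2 * m) * (- exp (- 2 * h)) ^ (2 * r - 1) / (1 + (- exp (- 2 * h)) ^ (2 * r - 1)))"
  have "((\<lambda>r. of_int (2 * int r - 1) ^ (2 * m) * en_coeff (2 * int r - 1) * exp (of_int (2 * int r - 1) * ?x)) 
      has_sum deriv_sum en_coeff (2 * m) ?x / 2) {1..}"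
  proof (rule has_sum_int_symmetric_odd[OF deriv_sum_has_sum[OF strip_coeffs_en strip_half_pi]])
    show "of_int (- j) ^ (2 * m) * en_coeff (- j) * exp (of_int (- j) * ?x) = of_int j ^ (2 * m) * en_coeff j * exp (of_int j * ?x)" for j
      using exp_half_pi_reflect[of j] by (cases "odd j") (simp_all add: en_coeff_def sgn_minus algebra_simps)
  qed (auto simp: en_coeff_def)
  hence "((\<lambda>r. (- 2 * \<i>) * complex_of_real (?t r)) has_sum deriv_sum en_coeff (2 * m) ?x / 2) {1..}"
  proof (rule iffD1[OF has_sum_cong, rotated])
    fix r :: nat assume "r \<in> {1..}"
    hence r: "r \<ge> 1" by simp
    hence "odd (2 * r - 1)" by simp
    \<comment> \<open>At the argument \<open>- q\<close> the odd power changes sign, which turns the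
      denominator \<open>1 + x ^ (2 r - 1)\<close> of \<open>serR\<close> into the
      \<open>1 - q ^ (2 r - 1)\<close> of \<open>coth - 1\<close>.\<close>
    hence p: "(- exp (- 2 * h)) ^ (2 * r - 1) = - (exp (- ((2 * real r - 1) * h)) ^ 2)"
      unfolding nome_odd_power[OF r, symmetric] by (rule power_minus_odd)
    have "(2 * real r - 1) * h > 0" using h_pos r by simp
    hence "(2 * real r - 1) ^ (2 * m) * (1 / tanh ((2 * real r - 1) * h) - 1) * (- 1) ^ r = 2 * ?t r"
      unfolding p by (subst coth_minus_one_eq) simp_all
    from arg_cong[OF this, of "\<lambda>x. - \<i> * complex_of_real x"]
    show "of_int (2 * int r - 1) ^ (2 * m) * en_coeff (2 * int r - 1) * exp (of_int (2 * int r - 1) * ?x) = (- 2 * \<i>) * complex_of_real (?t r)"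
      unfolding exp_odd_half_pi[OF r] using r by (simp add: en_coeff_def mult_ac)
  qed
  from has_sum_eq_cmult_infsum_of_real[OF this] show ?thesis
    by (simp add: serR_def)
qed

end

context nome_parameter
begin

section \<open>The Lambert series in terms of c0 and d0, and the four identities\<close>

lemma serT_values:
  "serT 0 (exp (- 2 * h)) = c0 / 4"
  "serT 1 (exp (- 2 * h)) = c0 * d0 ^ 2 / 4"
  "serT 2 (exp (- 2 * h)) = (4 * c0 ^ 2 + d0 ^ 2) * (c0 * d0 ^ 2) / 4"
  using deriv_sum_cn[of 0] deriv_sum_cn[of 1] deriv_sum_cn[of 2] cn_derivs
  by (simp_all add: cn_0[unfolded cn_def] complex_eq_iff del: of_real_mult of_real_add of_real_power)

lemma serN_values:
  "serN 0 (exp (- 2 * h)) = (d0 - 1) / 4"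
  "serN 1 (exp (- 2 * h)) = c0 ^ 2 * d0 / 16"
  "serN 2 (exp (- 2 * h)) = (4 * d0 ^ 2 + c0 ^ 2) * (c0 ^ 2 * d0) / 64"
  using deriv_sum_dn[of 0] deriv_sum_dn[of 1] deriv_sum_dn[of 2] dn_derivs
  by (simp_all add: dn_0[unfolded dn_def] complex_eq_iff del: of_real_mult of_real_add of_real_power)

lemma serThat_values:
  "serThat 0 (exp (- 2 * h)) = - c0 / 4"
  "serThat 1 (exp (- 2 * h)) = - c0 * (d0 ^ 2 - c0 ^ 2) / 4"
  "serThat 2 (exp (- 2 * h)) = - c0 * (d0 ^ 2 - c0 ^ 2) * (d0 ^ 2 - 5 * c0 ^ 2) / 4"
  using deriv_sum_sn[of 0] deriv_sum_sn[of 1] deriv_sum_sn[of 2] sn_derivs sn_half_pi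
  by (simp_all add: sn_def complex_eq_iff del: of_real_mult of_real_diff of_real_power)

lemma serR_values:
  "4 * serR 0 (- exp (- 2 * h)) - 1 = - d0"
  "4 * serR 1 (- exp (- 2 * h)) + 1 = d0 * (d0 ^ 2 - c0 ^ 2)"
  "4 * serR 2 (- exp (- 2 * h)) - 5 = - d0 * (5 * d0 ^ 2 - c0 ^ 2) * (d0 ^ 2 - c0 ^ 2)"
  using deriv_sum_en[of 0] deriv_sum_en[of 1] deriv_sum_en[of 2] en_derivs
  by (simp_all add: complex_eq_iff del: of_real_mult of_real_diff of_real_power deriv_sum_0)

end

theorem theorem5p20:
  fixes k z q :: real
  assumes "0 < k" and "k < 1"
    and "z = 2 * ellipticK k / pi"
    and "q = exp (- pi * ellipticK (sqrt (1 - k\<^sup>2)) / ellipticK k)"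
  shows
    "(k * z) ^ 6 =
        4 * det (mat2 (serT 0 q) (serT 1 q)
                      (serT 1 q) (serT 2 q))
      + 4 * det (mat2 (serThat 0 q) (serThat 1 q)
                      (serThat 1 q) (serThat 2 q))
   \<and> k ^ 4 * z ^ 6 =
        4 * det (mat2 (serT 0 q) (serT 1 q)
                      (serT 1 q) (serT 2 q))
   \<and> k ^ 2 * z ^ 6 =
        4 ^ 2 * serN 2 q
      + 4 ^ 3 * det (mat2 (serN 0 q) (serN 1 q)
                          (serN 1 q) (serN 2 q))
   \<and> z ^ 6 =
        4 ^ 2 * serN 2 q
      + 4 ^ 3 * det (mat2 (serN 0 q) (serN 1 q)
                          (serN 1 q) (serN 2 q))
      + 1 / 4 * det (mat2 (4 * serR 0 (- q) - 1) (4 * serR 1 (- q) + 1)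
                          (4 * serR 1 (- q) + 1) (4 * serR 2 (- q) - 5))"
proof -
  define K K' where "K = ellipticK k" and "K' = ellipticK (sqrt (1 - k\<^sup>2))"
  have "k\<^sup>2 < 1" "k\<^sup>2 > 0" using assms by (auto simp: power_less_one_iff)
  hence pos: "K > 0" "K' > 0"
    using assms unfolding K_def K'_def by (auto intro!: ellipticK_pos)
  \<comment> \<open>Chosen so that \<open>q = exp (- 2 * h)\<close>. Equivalently
    \<open>K' / K = 2 * h / pi\<close>, which is the ratio of \<open>d0 * h\<close> to
    \<open>d0 * (pi / 2)\<close>.\<close>
  define h where "h = pi * K' / (2 * K)"
  interpret nome_parameter h
    using pos by unfold_locales (simp add: h_def)
  have q: "q = exp (- 2 * h)"
    using assms pos by (simp add: h_def K_def K'_def field_simps)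
  have "k = c0 / d0"
  proof (rule ellipticK_ratio_inj)
    show "0 < c0 / d0" "c0 / d0 < 1" using c0_pos d0_pos c0_less_d0 by auto
    show "ellipticK (sqrt (1 - k\<^sup>2)) / ellipticK k = ellipticK (sqrt (1 - (c0 / d0)\<^sup>2)) / ellipticK (c0 / d0)"
      unfolding ellipticK_modulus ellipticK_complementary_modulus K_def[symmetric] K'_def[symmetric]
      using d0_pos pos by (simp add: h_def field_simps)
  qed (use assms in auto)
  moreover from this have "z = d0"
    using assms ellipticK_modulus by simp
  ultimately have k: "k * d0 = c0" and z: "z = d0"
    using d0_pos by auto
  \<comment> \<open>After \<open>c0\<close> is replaced by \<open>k * d0\<close>, all four claims
    are polynomial identities in \<open>k\<close> and \<open>d0\<close>.\<close>
  show ?thesis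
    unfolding q serT_values serThat_values serN_values serR_values det_2 z k[symmetric]
    by (simp add: algebra_simps add_divide_distrib diff_divide_distrib power2_eq_square eval_nat_numeral)
qed

end
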